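(* Let $n,N\ge 1$, let $q_{o1},\ldots,q_{oN}\in\mathbb{R}^n$, let $d_{s1},\ldots,d_{sN}>0$, $\bar v>0$, $d_r>0$, let $v_c:\mathbb{R}_+\to\mathbb{R}^n$ satisfy $|v_c(t)|\le\bar v_c$ and $|\dot v_c(t)|\le v_c^d$ for all $t\ge 0$ with positive constants $\bar v_c,v_c^d$, and suppose that the obstacle distance assumption stated in the context holds with constants $d_a,d_b,d_h$. Put $\underline d_s=\min_i d_{si}$, $\bar d_s=\max_i d_{si}$, and suppose $$\sqrt2\,\underline d_s>d_a,\qquad \bar v>2d_r,\qquad \frac{2\underline d_s^2-d_a^2}{2(\bar d_s+d_b/2)^2}>1-\frac{(\bar v-2d_r)^2}{2(\bar v-d_r)^2}.$$ Let $$c^*=\frac{(2\bar d_s+d_b)^2-4\underline d_s^2+2d_a^2}{2(2\bar d_s+d_b)^2},\qquad \kappa=\sqrt{c^*+\frac{d_r}{\bar v-d_r}}-\sqrt{c^*}.$$ Then there exist a Lipschitz continuous, nonnegative, decreasing (i.e. non-increasing) function $\phi:[-1,1]\to\mathbb{R}_+$, a constant $0<c_0<1$, and a Lipschitz function $\alpha_c\in\mathcal{K}^e$ whose inverse function is also Lipschitz, satisfying $$c_0>\sqrt{c^*}+\sqrt{c^*+\frac{d_r}{\bar v-d_r}},$$ $$c_0(\bar v-d_r)\ \ge\ c_0\alpha_c\!\left(\frac{d_b}{2}\right)-d_r\ >\ \frac{d_r-c_0\alpha_c(-d_h)}{\kappa},$$ $$\phi(s)>\max_{p\in[0,d_h]}\left\{\max_{K\in\left\{c_0(\bar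 v-d_r),\ \frac{d_r-c_0\alpha_c(-p)}{\kappa}\right\}}\left\{\alpha_c^{-1}\!\left(\frac{-K(s-c_0)}{c_0}+\frac{-K\kappa+d_r}{c_0}\right)\right\}+p\right\},\quad s\in[-1,c_0),$$ $$\phi(s)=0,\quad s\in[c_0,1].$$ Moreover, consider the kinematics $\dot q=v^*+\tilde v$, where $v^*$ is the solution of the quadratic program (QP) defined in the context and $\tilde v\in\mathbb{R}^n$ is the velocity-tracking error. There exists a constant $\Delta_h>0$ such that if $h_i(q)\ge-\Delta_h$ for $i=1,\ldots,N$, then: (a) the problem (QP) admits a unique solution; (b) the position trajectories satisfy $$\frac{\partial h_i(q)}{\partial q}\dot q\ \ge\ -\alpha_p(h_i(q))+d_r-|\tilde v|,\quad i=1,\ldots,N,$$ with $\alpha_p(s)=\max\{\alpha_c(s),c_0\alpha_c(s)\}$, and the velocity reference signal satisfies $|v^*|\le\bar v-d_r$; (c) the map $\varphi$, $v^*=\varphi(q,v_c)$, generated by solving (QP) satisfies $$|\varphi(q_1,v_{c1})-\varphi(q_2,v_{c2})|\le L(|q_1-q_2|+|v_{c1}-v_{c2}|)$$ for all $q_1,q_2$ satisfying $h_i(q_1)\ge-\Delta_h$ and $h_i(q_2)\ge-\Delta_h$ for $i=1,\ldots,N$, and all $v_{c1},v_{c2}\in\mathbb{R}^n$, where $L$ is a positive constant.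
   Context: $|\cdot|$ is the Euclidean norm; $\mathbb{R}_+=[0,\infty)$. A continuous function $\alpha:\mathbb{R}\to\mathbb{R}$ is of class $\mathcal{K}^e$ if it is strictly increasing and $\alpha(0)=0$. Obstacle functions: $h_i(q)=|q_{oi}-q|-d_{si}$, $i=1,\ldots,N$. Obstacle distance assumption: there exist constants $d_a,d_b,d_h>0$ with $d_a<\min_i d_{si}$ and $d_h<\min_i d_{si}$ such that for any $q\in\mathbb{R}^n$ with $h_i(q)\ge-d_h$ for all $i=1,\ldots,N$, if $h_j(q)\le d_b/2$ and $h_k(q)\le d_b/2$ for some $j,k\in\{1,\ldots,N\}$, then $|q_{oj}-q_{ok}|\le d_a$. Positive basis: for the given $c_0\in(0,1)$, $\mathcal{L}=\{l_1,\ldots,l_m\}\subset\mathbb{R}^n$ is a fixed finite set of unit vectors such that any unit vector $l_o\in\mathbb{R}^n$ is a positive combination of the elements of $\{l_p: l_p^Tl_o\ge c_0,\ p=1,\ldots,m\}$, and this set has cardinality not less than $n$. For $q\ne q_{o1},\ldots,q_{oN}$ let $l_{oi}(q)=\dfrac{q_{oi}-q}{|q_{oi}-q|}$ and $$r(q,l_k)=\min_{i=1,\ldots,N}\{|q_{oi}-q|-d_{si}+\phi(l_{oi}^T(q)l_k)\}.$$ (QP): $v^*=\operatorname{argmin}_{v^*\in\mathbb{R}^n}|v^*-v_c|^2$ subject to $$l_k^Tv^*\le c_0\alpha_c(r(q,l_k))-d_r,\qquad l_k^Tv^*\le c_0(\bar v-d_r),\qquad k=1,\ldots,m.$$ When (QP)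 has a unique solution, $\varphi(q,v_c)$ denotes that solution. *)

theory Defs
  imports "HOL-Analysis.Analysis"
begin

type_synonym 'n centres = "nat \<Rightarrow> real ^ 'n"

definition obstacle_fun :: "'n::finite centres \<Rightarrow> (nat \<Rightarrow> real) \<Rightarrow> nat \<Rightarrow> real ^ 'n \<Rightarrow> real" where
  "obstacle_fun qo ds i q = norm (qo i - q) - ds i"

definition safe_region :: "nat \<Rightarrow> 'n::finite centres \<Rightarrow> (nat \<Rightarrow> real) \<Rightarrow> real \<Rightarrow> (real ^ 'n) set" where
  "safe_region N qo ds \<delta> = {q. \<forall>i\<in>{1..N}. obstacle_fun qo ds i q \<ge> - \<delta>}"

definition obstacle_distance_assumption ::
    "nat \<Rightarrow> 'n::finite centres \<Rightarrow> (nat \<Rightarrow> real) \<Rightarrow> real \<Rightarrow> real \<Rightarrow> real \<Rightarrow> bool" where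
  "obstacle_distance_assumption N qo ds da db dh \<longleftrightarrow>
     da > 0 \<and> db > 0 \<and> dh > 0 \<and> da < Min (ds ` {1..N}) \<and> dh < Min (ds ` {1..N}) \<and>
     (\<forall>q\<in>safe_region N qo ds dh. \<forall>j\<in>{1..N}. \<forall>k\<in>{1..N}.
        obstacle_fun qo ds j q \<le> db / 2 \<and> obstacle_fun qo ds k q \<le> db / 2
          \<longrightarrow> norm (qo j - qo k) \<le> da)"

definition c_star :: "nat \<Rightarrow> (nat \<Rightarrow> real) \<Rightarrow> real \<Rightarrow> real \<Rightarrow> real" where
  "c_star N ds da db =
     ((2 * Max (ds ` {1..N}) + db)\<^sup>2 - 4 * (Min (ds ` {1..N}))\<^sup>2 + 2 * da\<^sup>2)
       / (2 * (2 * Max (ds ` {1..N}) + db)\<^sup>2)"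

definition kappa :: "nat \<Rightarrow> (nat \<Rightarrow> real) \<Rightarrow> real \<Rightarrow> real \<Rightarrow> real \<Rightarrow> real \<Rightarrow> real" where
  "kappa N ds da db vbar dr =
     sqrt (c_star N ds da db + dr / (vbar - dr)) - sqrt (c_star N ds da db)"

definition class_Ke :: "(real \<Rightarrow> real) \<Rightarrow> bool" where
  "class_Ke \<alpha> \<longleftrightarrow> continuous_on UNIV \<alpha> \<and> strict_mono \<alpha> \<and> \<alpha> 0 = 0"

text \<open>The lower bound that \<open>\<phi> s\<close> has to exceed for \<open>s < c0\<close>. The outer maximum over
  \<open>p \<in> {0..dh}\<close> is of a continuous function on a compact interval, so it is written as a
  supremum.\<close>

definition phi_bound ::
    "(real \<Rightarrow> real) \<Rightarrow> real \<Rightarrow> real \<Rightarrow> real \<Rightarrow> real \<Rightarrow> real \<Rightarrow> real \<Rightarrow> real" where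
  "phi_bound \<alpha>c c0 \<kappa> dh dr vbar s =
     (SUP p\<in>{0..dh}.
        Max ((\<lambda>K. inv \<alpha>c ((- K * (s - c0)) / c0 + (- K * \<kappa> + dr) / c0)) `
               {c0 * (vbar - dr), (dr - c0 * \<alpha>c (- p)) / \<kappa>}) + p)"

text \<open>Only the values of \<open>\<phi>\<close> on \<open>{-1..1}\<close> are meaningful.\<close>

definition admissible_design ::
    "nat \<Rightarrow> (nat \<Rightarrow> real) \<Rightarrow> real \<Rightarrow> real \<Rightarrow> real \<Rightarrow> real \<Rightarrow> real
       \<Rightarrow> (real \<Rightarrow> real) \<Rightarrow> real \<Rightarrow> (real \<Rightarrow> real) \<Rightarrow> bool" where
  "admissible_design N ds da db dh vbar dr \<phi> c0 \<alpha>c \<longleftrightarrow>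
     (\<exists>M. M-lipschitz_on {-1..1} \<phi>) \<and> (\<forall>s\<in>{-1..1}. 0 \<le> \<phi> s) \<and> antimono_on {-1..1} \<phi> \<and>
     0 < c0 \<and> c0 < 1 \<and>
     class_Ke \<alpha>c \<and> (\<exists>M. M-lipschitz_on UNIV \<alpha>c) \<and>
     bij \<alpha>c \<and> (\<exists>M. M-lipschitz_on UNIV (inv \<alpha>c)) \<and>
     c0 > sqrt (c_star N ds da db) + sqrt (c_star N ds da db + dr / (vbar - dr)) \<and>
     c0 * (vbar - dr) \<ge> c0 * \<alpha>c (db / 2) - dr \<and>
     c0 * \<alpha>c (db / 2) - dr > (dr - c0 * \<alpha>c (- dh)) / kappa N ds da db vbar dr \<and>
     (\<forall>s\<in>{-1..<c0}. \<phi> s > phi_bound \<alpha>c c0 (kappa N ds da db vbar dr) dh dr vbar s) \<and>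
     (\<forall>s\<in>{c0..1}. \<phi> s = 0)"

text \<open>As usual for positive spanning sets, the coefficients of a positive combination are
  nonnegative.\<close>

definition positive_combination :: "(real ^ 'n::finite) set \<Rightarrow> real ^ 'n \<Rightarrow> bool" where
  "positive_combination S x \<longleftrightarrow> (\<exists>a. (\<forall>l\<in>S. 0 \<le> a l) \<and> x = (\<Sum>l\<in>S. a l *\<^sub>R l))"

definition positive_basis :: "real \<Rightarrow> (real ^ 'n::finite) set \<Rightarrow> bool" where
  "positive_basis c0 \<L> \<longleftrightarrow>
     finite \<L> \<and> (\<forall>l\<in>\<L>. norm l = 1) \<and>
     (\<forall>lo. norm lo = 1 \<longrightarrow>
        positive_combination {l\<in>\<L>. l \<bullet> lo \<ge> c0} lo \<and> card {l\<in>\<L>. l \<bullet> lo \<ge> c0} \<ge> CARD('n))"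

definition obstacle_dir :: "'n::finite centres \<Rightarrow> nat \<Rightarrow> real ^ 'n \<Rightarrow> real ^ 'n" where
  "obstacle_dir qo i q = (1 / norm (qo i - q)) *\<^sub>R (qo i - q)"

definition reshaped_dist ::
    "nat \<Rightarrow> 'n::finite centres \<Rightarrow> (nat \<Rightarrow> real) \<Rightarrow> (real \<Rightarrow> real) \<Rightarrow> real ^ 'n \<Rightarrow> real ^ 'n \<Rightarrow> real" where
  "reshaped_dist N qo ds \<phi> q l =
     Min ((\<lambda>i. norm (qo i - q) - ds i + \<phi> (obstacle_dir qo i q \<bullet> l)) ` {1..N})"

definition qp_feasible ::
    "nat \<Rightarrow> 'n::finite centres \<Rightarrow> (nat \<Rightarrow> real) \<Rightarrow> real \<Rightarrow> real \<Rightarrow> (real \<Rightarrow> real) \<Rightarrow> real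
       \<Rightarrow> (real \<Rightarrow> real) \<Rightarrow> (real ^ 'n) set \<Rightarrow> real ^ 'n \<Rightarrow> real ^ 'n \<Rightarrow> bool" where
  "qp_feasible N qo ds vbar dr \<phi> c0 \<alpha>c \<L> q v \<longleftrightarrow>
     (\<forall>l\<in>\<L>. l \<bullet> v \<le> c0 * \<alpha>c (reshaped_dist N qo ds \<phi> q l) - dr \<and> l \<bullet> v \<le> c0 * (vbar - dr))"

definition qp_solution ::
    "nat \<Rightarrow> 'n::finite centres \<Rightarrow> (nat \<Rightarrow> real) \<Rightarrow> real \<Rightarrow> real \<Rightarrow> (real \<Rightarrow> real) \<Rightarrow> real
       \<Rightarrow> (real \<Rightarrow> real) \<Rightarrow> (real ^ 'n) set \<Rightarrow> real ^ 'n \<Rightarrow> real ^ 'n \<Rightarrow> real ^ 'n \<Rightarrow> bool" where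
  "qp_solution N qo ds vbar dr \<phi> c0 \<alpha>c \<L> q w v \<longleftrightarrow>
     is_arg_min (\<lambda>u. (norm (u - w))\<^sup>2) (qp_feasible N qo ds vbar dr \<phi> c0 \<alpha>c \<L> q) v"

text \<open>Meaningful only where the quadratic program has exactly one solution.\<close>

definition qp_map ::
    "nat \<Rightarrow> 'n::finite centres \<Rightarrow> (nat \<Rightarrow> real) \<Rightarrow> real \<Rightarrow> real \<Rightarrow> (real \<Rightarrow> real) \<Rightarrow> real
       \<Rightarrow> (real \<Rightarrow> real) \<Rightarrow> (real ^ 'n) set \<Rightarrow> real ^ 'n \<Rightarrow> real ^ 'n \<Rightarrow> real ^ 'n" where
  "qp_map N qo ds vbar dr \<phi> c0 \<alpha>c \<L> q w = (THE v. qp_solution N qo ds vbar dr \<phi> c0 \<alpha>c \<L> q w v)"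

end

theory Submission
  imports Defs
begin

text \<open>In the direction \<open>u\<close> of the nearest obstacle, the retreat \<open>- K *\<^sub>R u\<close> satisfies all constraints of the
  quadratic program: obstacles closer than \<open>db / 2\<close> have unit directions within distance
  \<open>2 * sqrt c_star\<close> of \<open>u\<close>, and \<open>\<phi>\<close> was chosen to compensate exactly this deviation. Bound (b) comes from writing
  unit vectors as positive combinations of nearby basis elements. For the Lipschitz estimate, the
  constraint normals are fixed and only the right-hand sides depend on \<open>q\<close>; projecting a point onto
  \<open>{x. \<forall>l. l \<bullet> x \<le> b l}\<close> is piecewise affine in \<open>b\<close>, with finitely many pieces.\<close>

subsection \<open>Projections onto polyhedra\<close>

text \<open>The constants fit together as follows. The law of cosines makes
  \<open>2 * sqrt c_star\<close> a chord bound, and \<open>c0 - 2 * sqrt c_star > kappa\<close> says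
  that the retreat keeps a component larger than \<open>kappa\<close> along every normal within the
  cone of \<open>c0\<close>. Since
  \<open>kappa * (kappa + 2 * sqrt c_star) = dr / (vbar - dr)\<close>, it follows that
  \<open>kappa * c0 * (vbar - dr) > dr\<close>: retreating at the saturated speed beats the margin
  \<open>dr\<close>. The gap hypothesis says exactly that such a \<open>c0\<close> below 1 exists.
  The obstacle in the Lipschitz estimate is that the safe region is in general not convex: a segment
  between two safe positions may cross an obstacle, where feasibility is not guaranteed. Hence the
  interpolation runs between right-hand sides, whose feasible sets contain convex combinations of
  points feasible at the two ends.\<close>

definition halfspaces_inter :: "'a::euclidean_space set \<Rightarrow> ('a \<Rightarrow> real) \<Rightarrow> 'a set" where
  "halfspaces_inter A b = {x. \<forall>l\<in>A. l \<bullet> x \<le> b l}"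

lemma closed_halfspaces_inter: "closed (halfspaces_inter A b)"
proof -
  have "halfspaces_inter A b = (\<Inter>l\<in>A. {x. l \<bullet> x \<le> b l})"
    by (auto simp: halfspaces_inter_def)
  then show ?thesis by (simp add: closed_INT closed_halfspace_le)
qed

lemma convex_halfspaces_inter: "convex (halfspaces_inter A b)"
proof -
  have "halfspaces_inter A b = (\<Inter>l\<in>A. {x. l \<bullet> x \<le> b l})"
    by (auto simp: halfspaces_inter_def)
  then show ?thesis by (simp add: convex_INT convex_halfspace_le)
qed

lemma halfspaces_inter_combine:
  assumes "x \<in> halfspaces_inter A b" "y \<in> halfspaces_inter A b'" "0 \<le> t" "t \<le> 1"
  shows "(1 - t) *\<^sub>R x + t *\<^sub>R y \<in> halfspaces_inter A (\<lambda>l. (1 - t) * b l + t * b' l)"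
  using assms
  by (auto simp: halfspaces_inter_def inner_add_right intro!: add_mono mult_left_mono)

text \<open>The coordinate functional of \<open>l\<close> is represented by the vector
  \<open>adjoint g 1\<close>. Its component orthogonal to \<open>span B\<close> does not affect
  inner products with \<open>B\<close>, so projecting it into \<open>span B\<close> keeps the
  duality.\<close>

lemma dual_basis_exists:
  fixes B :: "'a::euclidean_space set"
  assumes "independent B"
  shows "\<exists>d. \<forall>l\<in>B. d l \<in> span B \<and> (\<forall>l'\<in>B. l' \<bullet> d l = (if l' = l then 1 else 0))"
proof -
  have "\<exists>d. d \<in> span B \<and> (\<forall>l'\<in>B. l' \<bullet> d = (if l' = l then 1 else 0))" if "l \<in> B" for l
  proof -
    obtain g :: "'a \<Rightarrow> real" where g: "linear g" "\<forall>x\<in>B. g x = (if x = l then 1 else 0)"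
      using linear_independent_extend[OF assms, of "\<lambda>x. if x = l then 1 else 0"] by auto
    obtain y z where yz: "y \<in> span B" "\<And>w. w \<in> span B \<Longrightarrow> orthogonal z w" "adjoint g 1 = y + z"
      using orthogonal_subspace_decomp_exists[of B "adjoint g 1"] by metis
    have "l' \<bullet> y = (if l' = l then 1 else 0)" if "l' \<in> B" for l'
    proof -
      have "l' \<bullet> adjoint g 1 = g l'"
        using adjoint_works[OF g(1), of l' 1] by simp
      moreover have "l' \<bullet> z = 0"
        using yz(2)[OF span_base[OF that]] by (simp add: orthogonal_def inner_commute)
      ultimately show ?thesis using yz(3) g(2) that by (simp add: inner_add_right)
    qed
    then show ?thesis using yz(1) by blast
  qed
  then show ?thesis by metis
qed

text \<open>Where \<open>B\<close> is independent and \<open>d\<close> its dual basis, this is the orthogonal projection of \<open>w\<close>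
  onto the affine subspace where the constraints in \<open>B\<close> are active.\<close>

definition active_projection ::
    "('a \<Rightarrow> 'a) \<Rightarrow> 'a set \<Rightarrow> ('a \<Rightarrow> real) \<Rightarrow> 'a \<Rightarrow> 'a::euclidean_space" where
  "active_projection d B b w = w - (\<Sum>l\<in>B. (l \<bullet> w - b l) *\<^sub>R d l)"

lemma norm_active_projection_diff_le:
  assumes "finite A" "B \<subseteq> A"
  shows "norm (active_projection d B b w - active_projection d B b' w)
           \<le> (\<Sum>l\<in>B. norm (d l)) * (\<Sum>l\<in>A. \<bar>b l - b' l\<bar>)"
proof -
  have "active_projection d B b w - active_projection d B b' w = (\<Sum>l\<in>B. (b l - b' l) *\<^sub>R d l)"
    by (simp add: active_projection_def sum_subtractf[symmetric] algebra_simps)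
  also have "norm \<dots> \<le> (\<Sum>l\<in>B. \<bar>b l - b' l\<bar> * norm (d l))"
    using norm_sum[of "\<lambda>l. (b l - b' l) *\<^sub>R d l" B] by simp
  also have "\<dots> \<le> (\<Sum>l\<in>B. (\<Sum>l\<in>A. \<bar>b l - b' l\<bar>) * norm (d l))"
    using assms by (intro sum_mono mult_right_mono member_le_sum) auto
  finally show ?thesis by (simp only: sum_distrib_right mult.commute)
qed

text \<open>First-order optimality puts \<open>w - v\<close> into the span of the active normals.
  These may be dependent, so \<open>B\<close> is a maximal independent subset with the same span;
  then \<open>v\<close> is the only point of \<open>w + span B\<close> at which the constraints of
  \<open>B\<close> are equalities.\<close>

lemma closest_point_eq_active_projection:
  fixes A :: "'a::euclidean_space set"
  assumes "finite A" "halfspaces_inter A b \<noteq> {}"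
    and d: "\<And>B. independent B \<Longrightarrow>
      \<forall>l\<in>B. d B l \<in> span B \<and> (\<forall>l'\<in>B. l' \<bullet> d B l = (if l' = l then 1 else 0))"
  shows "\<exists>B\<subseteq>A. closest_point (halfspaces_inter A b) w = active_projection (d B) B b w"
proof -
  let ?P = "halfspaces_inter A b"
  define v where "v = closest_point ?P w"
  have vP: "v \<in> ?P"
    unfolding v_def by (rule closest_point_in_set[OF closed_halfspaces_inter assms(2)])
  obtain B where B: "B \<subseteq> {l\<in>A. l \<bullet> v = b l}" "independent B" "{l\<in>A. l \<bullet> v = b l} \<subseteq> span B"
    using maximal_independent_subset by blast
  have finB: "finite B" using B(1) assms(1) by (auto intro: finite_subset)
  obtain y z where yz: "y \<in> span B" "\<And>x. x \<in> span B \<Longrightarrow> orthogonal z x" "w - v = y + z"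
    using orthogonal_subspace_decomp_exists[of B "w - v"] by metis
  \<comment> \<open>Moving along \<open>z\<close> keeps the active constraints active, hence stays feasible for a while.\<close>
  have "\<forall>\<^sub>F e in at_right (0::real). \<forall>l\<in>A. l \<bullet> (v + e *\<^sub>R z) \<le> b l"
  proof (rule eventually_ball_finite[OF assms(1)], rule ballI)
    fix l assume l: "l \<in> A"
    show "\<forall>\<^sub>F e in at_right (0::real). l \<bullet> (v + e *\<^sub>R z) \<le> b l"
    proof (cases "l \<bullet> v = b l")
      case True
      then have "l \<bullet> z = 0" using yz(2) B(3) l by (auto simp: orthogonal_def inner_commute)
      then show ?thesis using True by (simp add: inner_add_right)
    next
      case False
      then have "l \<bullet> (v + 0 *\<^sub>R z) < b l" using vP l by (force simp: halfspaces_inter_def)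
      moreover have "((\<lambda>e. l \<bullet> (v + e *\<^sub>R z)) \<longlongrightarrow> l \<bullet> (v + 0 *\<^sub>R z)) (at_right (0::real))"
        by (intro tendsto_intros)
      ultimately show ?thesis
        by (auto dest!: order_tendstoD(2) elim: eventually_mono)
    qed
  qed
  then have "\<forall>\<^sub>F e in at_right (0::real). 0 < e \<and> v + e *\<^sub>R z \<in> ?P"
    using eventually_at_right_less[of "0::real"]
    by eventually_elim (auto simp: halfspaces_inter_def)
  then obtain e :: real where e: "0 < e" "v + e *\<^sub>R z \<in> ?P"
    using eventually_happens' trivial_limit_at_right_real by blast
  \<comment> \<open>The variational inequality of the projection, tested at this feasible point,
    bounds \<open>e * (z \<bullet> z)\<close> by zero because \<open>y\<close> is orthogonal to
    \<open>z\<close>.\<close>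
  have "(w - v) \<bullet> (v + e *\<^sub>R z - v) \<le> 0"
    unfolding v_def
    by (rule closest_point_dot[OF convex_halfspaces_inter closed_halfspaces_inter])
       (use e(2) v_def in auto)
  moreover have "y \<bullet> z = 0" using yz by (auto simp: orthogonal_def inner_commute)
  ultimately have "z \<bullet> z \<le> 0"
    using e(1) yz(3) by (auto simp: inner_add_left mult_le_0_iff)
  then have "z = 0" by (metis inner_ge_zero inner_eq_zero_iff order_antisym)
  then have uB: "w - v \<in> span B" using yz by simp
  define x where "x = v - active_projection (d B) B b w"
  have "(\<Sum>l\<in>B. (l \<bullet> w - b l) *\<^sub>R d B l) - (w - v) \<in> span B"
    by (intro span_diff span_sum span_scale uB) (use d[OF B(2)] in auto)
  then have xB: "x \<in> span B" by (simp add: x_def active_projection_def algebra_simps)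
  have "l \<bullet> x = 0" if l: "l \<in> B" for l
  proof -
    have "l \<bullet> (\<Sum>k\<in>B. (k \<bullet> w - b k) *\<^sub>R d B k) = (\<Sum>k\<in>B. if k = l then l \<bullet> w - b l else 0)"
      unfolding inner_sum_right by (intro sum.cong) (use d[OF B(2)] l in auto)
    moreover have "l \<bullet> v = b l" using l B(1) by auto
    ultimately show ?thesis
      using finB l by (simp add: x_def active_projection_def inner_diff_right)
  qed
  then have "\<And>k. k \<in> span B \<Longrightarrow> orthogonal x k"
    using orthogonal_to_span[of _ B x] by (simp add: orthogonal_def inner_commute)
  from this[OF xB] have "x = 0" by (simp add: orthogonal_def)
  then show ?thesis using B(1) by (auto simp: x_def v_def intro!: exI[of _ B])
qed

text \<open>Along the segment from \<open>b\<close> to \<open>b'\<close> the projection agrees at each point with one of the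
  finitely many affine maps \<open>active_projection\<close>, on closed sets of parameters.\<close>

lemma closest_point_halfspaces_inter_lipschitz:
  fixes A :: "'a::euclidean_space set"
  assumes finA: "finite A"
  shows "\<exists>M\<ge>0. \<forall>w b b'. halfspaces_inter A b \<noteq> {} \<longrightarrow> halfspaces_inter A b' \<noteq> {} \<longrightarrow>
    norm (closest_point (halfspaces_inter A b) w - closest_point (halfspaces_inter A b') w)
      \<le> M * (\<Sum>l\<in>A. \<bar>b l - b' l\<bar>)"
proof -
  obtain d where d: "\<And>B::'a set. independent B \<Longrightarrow>
      \<forall>l\<in>B. d B l \<in> span B \<and> (\<forall>l'\<in>B. l' \<bullet> d B l = (if l' = l then 1 else 0))"
    using dual_basis_exists by metis
  \<comment> \<open>Summing over all subsets yields one constant for every affine piece, fixed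
    before \<open>w\<close>, \<open>b\<close> and \<open>b'\<close>.\<close>
  define M where "M = (\<Sum>B\<in>Pow A. \<Sum>l\<in>B. norm (d B l))"
  have M0: "M \<ge> 0" by (auto simp: M_def intro!: sum_nonneg)
  have MB: "(\<Sum>l\<in>B. norm (d B l)) \<le> M" if "B \<subseteq> A" for B
    unfolding M_def using that finA
    by (intro member_le_sum[where f = "\<lambda>B. \<Sum>l\<in>B. norm (d B l)"]) (auto intro!: sum_nonneg)
  have "norm (closest_point (halfspaces_inter A b) w - closest_point (halfspaces_inter A b') w)
      \<le> M * (\<Sum>l\<in>A. \<bar>b l - b' l\<bar>)"
    if ne: "halfspaces_inter A b \<noteq> {}" "halfspaces_inter A b' \<noteq> {}" for w b b'
  proof -
    define \<beta> where "\<beta> t l = (1 - t) * b l + t * b' l" for t :: real and l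
    define P where "P t = halfspaces_inter A (\<beta> t)" for t
    define f where "f t = closest_point (P t) w" for t
    define F where "F B t = active_projection (d B) B (\<beta> t) w" for B t
    define T where "T B = {t\<in>{0..1}. f t = F B t}" for B
    define \<delta> where "\<delta> = (\<Sum>l\<in>A. \<bar>b l - b' l\<bar>)"
    have P01: "P 0 = halfspaces_inter A b" "P 1 = halfspaces_inter A b'"
      by (simp_all add: P_def \<beta>_def[abs_def])
    \<comment> \<open>The graph of the set-valued map \<open>P\<close> is convex.\<close>
    have P_comb: "(1 - u) *\<^sub>R x + u *\<^sub>R y \<in> P ((1 - u) * s + u * t)"
      if "x \<in> P s" "y \<in> P t" "0 \<le> u" "u \<le> 1" for x y s t u
    proof -
      have "(\<lambda>l. (1 - u) * \<beta> s l + u * \<beta> t l) = \<beta> ((1 - u) * s + u * t)"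
        by (simp add: \<beta>_def fun_eq_iff algebra_simps)
      then show ?thesis
        using halfspaces_inter_combine[OF that[unfolded P_def]] by (simp add: P_def)
    qed
    obtain y0 y1 where y0: "y0 \<in> P 0" and y1: "y1 \<in> P 1" using ne P01 by auto
    have Pne: "P t \<noteq> {}" if "t \<in> {0..1}" for t
      using P_comb[OF y0 y1, of t] that by auto
    have clP: "closed (P t)" "convex (P t)" for t
      by (auto simp: P_def closed_halfspaces_inter convex_halfspaces_inter)
    have F_lip: "norm (F B s - F B t) \<le> (M * \<delta>) * \<bar>s - t\<bar>" if "B \<subseteq> A" for B s t
    proof -
      have "norm (F B s - F B t) \<le> (\<Sum>l\<in>B. norm (d B l)) * (\<Sum>l\<in>A. \<bar>\<beta> s l - \<beta> t l\<bar>)"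
        unfolding F_def by (rule norm_active_projection_diff_le[OF finA that])
      also have "(\<Sum>l\<in>A. \<bar>\<beta> s l - \<beta> t l\<bar>) = (\<Sum>l\<in>A. \<bar>b l - b' l\<bar> * \<bar>s - t\<bar>)"
      proof (intro sum.cong refl)
        fix l
        have "\<beta> s l - \<beta> t l = (b l - b' l) * (t - s)" by (simp add: \<beta>_def algebra_simps)
        then show "\<bar>\<beta> s l - \<beta> t l\<bar> = \<bar>b l - b' l\<bar> * \<bar>s - t\<bar>"
          by (simp add: abs_mult abs_minus_commute)
      qed
      also have "\<dots> = \<delta> * \<bar>s - t\<bar>" by (simp add: \<delta>_def sum_distrib_right)
      also have "(\<Sum>l\<in>B. norm (d B l)) * (\<delta> * \<bar>s - t\<bar>) \<le> M * (\<delta> * \<bar>s - t\<bar>)"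
        by (intro mult_right_mono MB that) (auto simp: \<delta>_def intro!: sum_nonneg mult_nonneg_nonneg)
      finally show ?thesis by (simp add: mult.assoc)
    qed
    \<comment> \<open>Lower semicontinuity of \<open>P\<close> at \<open>t\<close>: a competitor
      \<open>y\<close> is approximated in nearby sets by moving it towards \<open>y0\<close> or
      \<open>y1\<close>. The constant may depend on \<open>y\<close> and \<open>t\<close>, as it
      only serves a limit.\<close>
    have lower: "\<exists>C. \<forall>s\<in>{0..1}. \<exists>z\<in>P s. norm (z - y) \<le> C * \<bar>s - t\<bar>"
      if t: "t \<in> {0..1}" and y: "y \<in> P t" for t y
    proof -
      have one_sided: "\<exists>z\<in>P s. norm (z - y) \<le> norm (y' - y) / \<bar>t' - t\<bar> * \<bar>s - t\<bar>"
        if "y' \<in> P t'" "s = t + u * (t' - t)" "0 \<le> u" "u \<le> 1" "t' \<noteq> t" for y' t' s u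
      proof
        show "(1 - u) *\<^sub>R y + u *\<^sub>R y' \<in> P s"
        proof -
          have "(1 - u) * t + u * t' = s" using that(2) by (simp add: algebra_simps)
          then show ?thesis using P_comb[OF y that(1,3,4)] by simp
        qed
        have "(1 - u) *\<^sub>R y + u *\<^sub>R y' - y = u *\<^sub>R (y' - y)" by (simp add: algebra_simps)
        then show "norm ((1 - u) *\<^sub>R y + u *\<^sub>R y' - y) \<le> norm (y' - y) / \<bar>t' - t\<bar> * \<bar>s - t\<bar>"
          using that by (simp add: abs_mult)
      qed
      \<comment> \<open>At \<open>t = 0\<close> or \<open>t = 1\<close> one summand is 0 because
        \<open>x / 0 = 0\<close>; it belongs to a side of \<open>t\<close> on which no
        \<open>s\<close> lies.\<close>
      define C where "C = norm (y0 - y) / \<bar>0 - t\<bar> + norm (y1 - y) / \<bar>1 - t\<bar>"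
      have "\<exists>z\<in>P s. norm (z - y) \<le> C * \<bar>s - t\<bar>" if s: "s \<in> {0..1}" for s
      proof -
        consider "s = t" | "s < t" | "t < s" by linarith
        then show ?thesis
        proof cases
          case 1
          then show ?thesis using y by auto
        next
          case 2
          have "\<exists>z\<in>P s. norm (z - y) \<le> norm (y0 - y) / \<bar>0 - t\<bar> * \<bar>s - t\<bar>"
            by (rule one_sided[OF y0, where u = "(t - s) / t"]) (use 2 s t in \<open>auto simp: field_simps\<close>)
          moreover have "norm (y0 - y) / \<bar>0 - t\<bar> * \<bar>s - t\<bar> \<le> C * \<bar>s - t\<bar>"
            by (rule mult_right_mono) (auto simp: C_def)
          ultimately show ?thesis by (meson order_trans)
        next
          case 3
          have "\<exists>z\<in>P s. norm (z - y) \<le> norm (y1 - y) / \<bar>1 - t\<bar> * \<bar>s - t\<bar>"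
            by (rule one_sided[OF y1, where u = "(s - t) / (1 - t)"]) (use 3 s t in \<open>auto simp: field_simps\<close>)
          moreover have "norm (y1 - y) / \<bar>1 - t\<bar> * \<bar>s - t\<bar> \<le> C * \<bar>s - t\<bar>"
            by (rule mult_right_mono) (auto simp: C_def)
          ultimately show ?thesis by (meson order_trans)
        qed
      qed
      then show ?thesis by blast
    qed
    \<comment> \<open>Continuity of \<open>f\<close> is not yet known, so the limit of the affine
      piece is shown to be the projection itself: feasibility passes to the limit, and minimality
      follows by comparison with the approximants from \<open>lower\<close>.\<close>
    have "closed (T B)" if BA: "B \<subseteq> A" for B
      unfolding closed_sequential_limits
    proof (intro allI impI, elim conjE)
      fix x t assume x: "\<forall>n. x n \<in> T B" and lim: "x \<longlonglongrightarrow> t"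
      have x01: "x n \<in> {0..1}" and fx: "f (x n) = F B (x n)" for n
        using x by (auto simp: T_def)
      have t: "t \<in> {0..1}"
        using closed_sequentially[OF closed_atLeastAtMost, of x 0 1 t] x01 lim by auto
      have limF: "(\<lambda>n. F B (x n)) \<longlonglongrightarrow> F B t"
      proof (rule LIM_zero_cancel, rule Lim_null_comparison)
        show "\<forall>\<^sub>F n in sequentially. norm (F B (x n) - F B t) \<le> (M * \<delta>) * \<bar>x n - t\<bar>"
          using F_lip[OF BA] by simp
        show "(\<lambda>n. (M * \<delta>) * \<bar>x n - t\<bar>) \<longlonglongrightarrow> 0"
          by (rule tendsto_eq_intros refl lim)+ simp
      qed
      have "l \<bullet> F B t \<le> \<beta> t l" if l: "l \<in> A" for l
      proof (rule LIMSEQ_le)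
        show "(\<lambda>n. l \<bullet> F B (x n)) \<longlonglongrightarrow> l \<bullet> F B t" by (intro tendsto_intros limF)
        show "(\<lambda>n. \<beta> (x n) l) \<longlonglongrightarrow> \<beta> t l" unfolding \<beta>_def by (intro tendsto_intros lim)
        have "F B (x n) \<in> P (x n)" for n
          using closest_point_in_set[OF clP(1) Pne[OF x01]] fx by (metis f_def)
        then show "\<exists>N. \<forall>n\<ge>N. l \<bullet> F B (x n) \<le> \<beta> (x n) l"
          using l by (auto simp: P_def halfspaces_inter_def)
      qed
      then have FP: "F B t \<in> P t" by (auto simp: P_def halfspaces_inter_def)
      have "dist w (F B t) \<le> dist w y" if y: "y \<in> P t" for y
      proof -
        obtain C where C: "\<forall>s\<in>{0..1}. \<exists>z\<in>P s. norm (z - y) \<le> C * \<bar>s - t\<bar>"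
          using lower[OF t y] by blast
        show ?thesis
        proof (rule LIMSEQ_le)
          show "(\<lambda>n. dist w (F B (x n))) \<longlonglongrightarrow> dist w (F B t)" by (intro tendsto_intros limF)
          show "(\<lambda>n. dist w y + C * \<bar>x n - t\<bar>) \<longlonglongrightarrow> dist w y"
            by (rule tendsto_eq_intros refl lim)+ simp
          have "dist w (F B (x n)) \<le> dist w y + C * \<bar>x n - t\<bar>" for n
          proof -
            obtain z where z: "z \<in> P (x n)" "norm (z - y) \<le> C * \<bar>x n - t\<bar>" using C x01 by blast
            have "dist w (f (x n)) \<le> dist w z"
              unfolding f_def by (rule closest_point_le[OF clP(1) z(1)])
            also have "\<dots> \<le> dist w y + norm (z - y)"
              using dist_triangle[of w z y] by (simp add: dist_norm norm_minus_commute)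
            finally show ?thesis using z(2) fx by simp
          qed
          then show "\<exists>N. \<forall>n\<ge>N. dist w (F B (x n)) \<le> dist w y + C * \<bar>x n - t\<bar>" by blast
        qed
      qed
      then have "F B t = f t"
        unfolding f_def by (intro closest_point_unique[OF clP(2,1) FP]) auto
      then show "t \<in> T B" using t by (simp add: T_def)
    qed
    moreover have "(M * \<delta>)-lipschitz_on (T B) f" if "B \<subseteq> A" for B
    proof (rule lipschitz_onI)
      show "0 \<le> M * \<delta>" using M0 by (auto simp: \<delta>_def intro!: mult_nonneg_nonneg sum_nonneg)
      show "dist (f s) (f t) \<le> M * \<delta> * dist s t" if "s \<in> T B" "t \<in> T B" for s t
        using F_lip[OF \<open>B \<subseteq> A\<close>, of s t] that by (simp add: T_def dist_norm)
    qed
    moreover have "{0..1} \<subseteq> (\<Union>B\<in>Pow A. T B)"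
    proof
      fix t :: real assume t: "t \<in> {0..1}"
      have "\<exists>B\<subseteq>A. f t = F B t"
        unfolding f_def F_def P_def
        by (rule closest_point_eq_active_projection[OF finA _ d]) (use Pne[OF t] P_def in auto)
      then show "t \<in> (\<Union>B\<in>Pow A. T B)" using t by (auto simp: T_def)
    qed
    \<comment> \<open>Finitely many closed pieces with a common constant cover the interval, so the
      bound glues; the parameters 0 and 1 then give the claim.\<close>
    ultimately have "(M * \<delta>)-lipschitz_on {0..1} f"
      using finA M0 
      by (intro lipschitz_on_closed_Union[of "Pow A" _ T]) (auto simp: \<delta>_def intro!: mult_nonneg_nonneg sum_nonneg)
    from lipschitz_onD[OF this, of 0 1] show ?thesis
      by (simp add: dist_norm f_def P01 \<delta>_def)
  qed
  then show ?thesis using M0 by blast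
qed

subsection \<open>Existence of an admissible design\<close>

text \<open>Serves as \<alpha>c. The two sides need independent slopes: the value at
  \<open>db / 2\<close> has to be large, the value at \<open>- dh\<close> small in modulus.\<close>

definition two_slope :: "real \<Rightarrow> real \<Rightarrow> real \<Rightarrow> real" where
  "two_slope a b s = (if 0 \<le> s then a * s else b * s)"

lemma two_slope_inverse:
  assumes "0 < a" "0 < b"
  shows "two_slope (1 / a) (1 / b) (two_slope a b s) = s"
    and "two_slope a b (two_slope (1 / a) (1 / b) s) = s"
  using assms by (auto simp: two_slope_def zero_le_mult_iff zero_le_divide_iff mult_less_0_iff)

lemma inv_two_slope:
  assumes "0 < a" "0 < b"
  shows "inv (two_slope a b) = two_slope (1 / a) (1 / b)"
  using two_slope_inverse[OF assms] by (intro inv_equality) auto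

lemma bij_two_slope:
  assumes "0 < a" "0 < b"
  shows "bij (two_slope a b)"
  using two_slope_inverse[OF assms] by (intro o_bij[of "two_slope (1 / a) (1 / b)"]) (auto simp: fun_eq_iff)

lemma strict_mono_two_slope:
  assumes "0 < a" "0 < b"
  shows "strict_mono (two_slope a b)"
proof (rule strict_monoI)
  fix x y :: real assume xy: "x < y"
  have "x < 0 \<Longrightarrow> b * x < 0" "0 \<le> y \<Longrightarrow> 0 \<le> a * y" "a * x < a * y" "b * x < b * y"
    using assms xy by (auto simp: mult_pos_neg)
  then show "two_slope a b x < two_slope a b y" using xy by (auto simp: two_slope_def)
qed

lemma two_slope_lipschitz:
  assumes "0 < a" "0 < b"
  shows "(max a b)-lipschitz_on UNIV (two_slope a b)"
proof (rule lipschitz_onI)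
  have *: "two_slope a b y - two_slope a b x \<le> max a b * (y - x)" if "x \<le> y" for x y
  proof -
    have "a * y \<le> max a b * y" if "0 \<le> y"
      using that by (intro mult_right_mono) auto
    moreover have "max a b * x \<le> b * x" if "\<not> 0 \<le> x"
      using that by (intro mult_right_mono_neg) auto
    moreover have "a * (y - x) \<le> max a b * (y - x)" "b * (y - x) \<le> max a b * (y - x)"
      using that by (auto intro: mult_right_mono)
    ultimately show ?thesis using that
      unfolding two_slope_def right_diff_distrib by (smt (verit))
  qed
  have mono: "two_slope a b x \<le> two_slope a b y" if "x \<le> y" for x y
    using strict_mono_less_eq[OF strict_mono_two_slope[OF assms]] that by blast
  show "dist (two_slope a b x) (two_slope a b y) \<le> max a b * dist x y" for x y
    using *[of x y] *[of y x] mono[of x y] mono[of y x]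
    by (cases "x \<le> y") (auto simp: dist_real_def)
qed (use assms in auto)

lemma max_lipschitz_onI: 
  fixes f g :: "'a::metric_space \<Rightarrow> real"
  assumes "M-lipschitz_on S f" "M-lipschitz_on S g"
  shows "M-lipschitz_on S (\<lambda>x. max (f x) (g x))"
proof (rule lipschitz_onI)
  show "dist (max (f x) (g x)) (max (f y) (g y)) \<le> M * dist x y" if "x \<in> S" "y \<in> S" for x y
    using lipschitz_onD[OF assms(1) that] lipschitz_onD[OF assms(2) that]
    by (auto simp: dist_real_def max_def)
qed (rule lipschitz_on_nonneg[OF assms(1)])

text \<open>If two points at distances in \<open>{m..R}\<close> from an observer are at most
  \<open>da\<close> apart, the cosine of the viewing angle is at least
  \<open>(2 * m\<^sup>2 - da\<^sup>2) / (2 * R\<^sup>2)\<close>. This is \<open>1 - 2 * c\<close>,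
  so the unit directions differ by at most \<open>2 * sqrt c\<close>. The strict bound on
  \<open>da\<close> holds because \<open>R\<^sup>2 * (4 * c * m\<^sup>2 - da\<^sup>2)\<close>
  factors as \<open>(2 * m\<^sup>2 - da\<^sup>2) * (R\<^sup>2 - m\<^sup>2)\<close>.\<close>

lemma quadratic_gap:
  fixes m R da :: real
  assumes "0 < m" "m < R" "0 < da" "da < m"
  defines "c \<equiv> ((2 * R)\<^sup>2 - 4 * m\<^sup>2 + 2 * da\<^sup>2) / (2 * (2 * R)\<^sup>2)"
  shows "0 < c" "da < 2 * sqrt c * m" "(2 * m\<^sup>2 - da\<^sup>2) / (2 * R\<^sup>2) = 1 - 2 * c"
proof -
  have mR: "m\<^sup>2 < R\<^sup>2" and dm: "da\<^sup>2 < m\<^sup>2" using assms by (auto intro: power_strict_mono)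
  have R: "0 < R\<^sup>2" using mR by (meson le_less_trans zero_le_power2)
  show "0 < c" unfolding c_def using mR R assms(3)
    by (intro divide_pos_pos) (auto simp: power_mult_distrib intro: add_pos_nonneg)
  have c_eq: "4 * R\<^sup>2 * c = 2 * R\<^sup>2 - 2 * m\<^sup>2 + da\<^sup>2"
    using R by (simp add: c_def power_mult_distrib field_simps)
  have "(2 * m\<^sup>2 - da\<^sup>2) * (R\<^sup>2 - m\<^sup>2) > 0"
    using mR dm zero_le_power2[of m] by (intro mult_pos_pos) linarith+
  then have "R\<^sup>2 * da\<^sup>2 < (2 * R\<^sup>2 - 2 * m\<^sup>2 + da\<^sup>2) * m\<^sup>2"
    by (simp add: algebra_simps)
  also have "\<dots> = R\<^sup>2 * (4 * c * m\<^sup>2)" using c_eq by (simp add: c_eq[symmetric])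
  finally have "da\<^sup>2 < 4 * c * m\<^sup>2" using R by simp
  also have "\<dots> = (2 * sqrt c * m)\<^sup>2" using \<open>0 < c\<close> by (simp add: power_mult_distrib)
  finally show "da < 2 * sqrt c * m"
    by (rule power2_less_imp_less) (use assms \<open>0 < c\<close> in auto)
  show "(2 * m\<^sup>2 - da\<^sup>2) / (2 * R\<^sup>2) = 1 - 2 * c" using c_eq R by (simp add: field_simps)
qed

text \<open>Squaring \<open>sqrt (c + e) < 1 - sqrt c\<close> cancels \<open>c\<close> and leaves
  \<open>2 * sqrt c < 1 - e\<close>, the square root of the last hypothesis.\<close>

lemma sqrt_sum_less_one:
  fixes c e :: real
  assumes "0 < c" "0 < e" "e < 1" "c < (1 - e)\<^sup>2 / 4"
  shows "sqrt c + sqrt (c + e) < 1"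
proof -
  have "sqrt c < sqrt (((1 - e) / 2)\<^sup>2)" using assms by (simp add: power_divide)
  then have s: "2 * sqrt c < 1 - e" using assms by simp
  have "c + e < (1 - sqrt c)\<^sup>2" using s assms by (simp add: power2_eq_square algebra_simps)
  then have "sqrt (c + e) < sqrt ((1 - sqrt c)\<^sup>2)" by (rule real_sqrt_less_mono)
  then show ?thesis using s assms by simp
qed

section \<open>Constants of the obstacle geometry and existence of a design\<close>

locale obstacle_setting =
  fixes N :: nat and qo :: "nat \<Rightarrow> real ^ 'n::finite" and ds :: "nat \<Rightarrow> real"
    and vbar dr da db dh :: real
  assumes N: "N \<ge> 1"
    and dr: "dr > 0"
    and oda: "obstacle_distance_assumption N qo ds da db dh"
    and vbar: "vbar > 2 * dr"
    and gap: "(2 * (Min (ds ` {1..N}))\<^sup>2 - da\<^sup>2) / (2 * (Max (ds ` {1..N}) + db / 2)\<^sup>2)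
           > 1 - (vbar - 2 * dr)\<^sup>2 / (2 * (vbar - dr)\<^sup>2)"
begin

abbreviation "dmin \<equiv> Min (ds ` {1..N})"
abbreviation "V \<equiv> vbar - dr"
abbreviation "\<kappa> \<equiv> kappa N ds da db vbar dr"

definition "\<sigma> = sqrt (c_star N ds da db)"

lemma constants_pos: "0 < da" "0 < db" "0 < dh" "da < dmin" "dh < dmin" "0 < V"
  using oda dr vbar by (auto simp: obstacle_distance_assumption_def)

lemma dmin_le: "i \<in> {1..N} \<Longrightarrow> dmin \<le> ds i"
  by simp

lemma dmin_less: "dmin < Max (ds ` {1..N}) + db / 2"
proof -
  have "dmin \<le> ds 1" "ds 1 \<le> Max (ds ` {1..N})" using N by auto
  then show ?thesis using constants_pos by linarith
qed

lemma c_star_eq: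
  "c_star N ds da db = ((2 * (Max (ds ` {1..N}) + db / 2))\<^sup>2 - 4 * dmin\<^sup>2 + 2 * da\<^sup>2)
     / (2 * (2 * (Max (ds ` {1..N}) + db / 2))\<^sup>2)"
  by (simp add: c_star_def algebra_simps)

lemmas c_star_facts = quadratic_gap[OF _ dmin_less constants_pos(1,4), folded c_star_eq]

lemma dmin_pos: "0 < dmin"
  using constants_pos by linarith

lemma sigma_pos: "0 < \<sigma>"
  using c_star_facts(1)[OF dmin_pos] by (simp add: \<sigma>_def)

lemma da_less: "da < 2 * \<sigma> * dmin"
  using c_star_facts(2)[OF dmin_pos] by (simp add: \<sigma>_def)

lemma kappa_eq: "\<kappa> = sqrt (c_star N ds da db + dr / V) - \<sigma>"
  by (simp add: kappa_def \<sigma>_def)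

lemma kappa_pos: "0 < \<kappa>"
  using constants_pos dr by (simp add: kappa_eq \<sigma>_def)

text \<open>A difference of squares, as \<open>\<kappa> + 2 * \<sigma>\<close> is the conjugate of
  \<kappa>. Any \<open>c0\<close> above \<open>\<kappa> + 2 * \<sigma>\<close> therefore satisfies
  \<open>\<kappa> * c0 * V > dr\<close>, the margin on which the design lives.\<close>

lemma kappa_mult: "\<kappa> * (\<kappa> + 2 * \<sigma>) * V = dr"
proof -
  have "\<kappa> * (\<kappa> + 2 * \<sigma>) = (sqrt (c_star N ds da db + dr / V))\<^sup>2 - \<sigma>\<^sup>2"
    by (simp add: kappa_eq power2_eq_square algebra_simps)
  also have "\<dots> = dr / V"
    using c_star_facts(1)[OF dmin_pos] constants_pos dr by (simp add: \<sigma>_def)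
  finally show ?thesis using constants_pos by simp
qed

lemma kappa_sigma_less_one: "\<kappa> + 2 * \<sigma> < 1"
proof -
  have "c_star N ds da db < (1 - dr / V)\<^sup>2 / 4"
  proof -
    have "(vbar - 2 * dr) / V = 1 - dr / V" using constants_pos by (simp add: field_simps)
    then have "(vbar - 2 * dr)\<^sup>2 / (2 * V\<^sup>2) = (1 - dr / V)\<^sup>2 / 2"
      by (metis divide_divide_eq_left mult.commute power_divide)
    then show ?thesis using gap c_star_facts(3)[OF dmin_pos] by linarith
  qed
  then have "sqrt (c_star N ds da db) + sqrt (c_star N ds da db + dr / V) < 1"
    using constants_pos dr vbar c_star_facts(1)[OF dmin_pos] by (intro sqrt_sum_less_one) auto
  then show ?thesis by (simp add: kappa_eq \<sigma>_def)
qed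

text \<open>The lower bound for \<phi> decays at least linearly towards \<open>c0\<close>, so a
  Lipschitz function vanishing at \<open>c0\<close> can dominate it. Both gains satisfy
  \<open>- K * \<kappa> + dr \<le> c0 * \<alpha>c (- p)\<close>; at \<open>s = c0\<close> the
  inverse thus gives at most \<open>- p\<close>, which cancels the added \<open>p\<close>. Away from
  \<open>c0\<close>, \<open>K \<le> c0 * V\<close> bounds the growth.\<close>

lemma phi_bound_le:
  assumes "class_Ke \<alpha>c" "bij \<alpha>c" "M-lipschitz_on UNIV (inv \<alpha>c)" "0 < c0" "s < c0"
    and K: "c0 * V \<ge> (dr - c0 * \<alpha>c (- dh)) / \<kappa>"
  shows "phi_bound \<alpha>c c0 \<kappa> dh dr vbar s \<le> M * V * (c0 - s)"
  unfolding phi_bound_def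
proof (rule cSUP_least)
  fix p assume p: "p \<in> {0..dh}"
  have sm: "strict_mono \<alpha>c" "\<alpha>c 0 = 0" using assms(1) by (auto simp: class_Ke_def)
  have inv: "inv \<alpha>c (\<alpha>c x) = x" for x using assms(2) by (simp add: bij_is_inj inv_f_f)
  have smi: "strict_mono (inv \<alpha>c)"
    by (rule strict_mono_inv[OF sm(1) bij_is_surj[OF assms(2)] inv])
  have \<alpha>p: "\<alpha>c (- dh) \<le> \<alpha>c (- p)" "\<alpha>c (- p) \<le> \<alpha>c 0"
    using strict_mono_less_eq[OF sm(1)] p by auto
  have dhK: "dr - c0 * \<alpha>c (- p) \<le> c0 * V * \<kappa>"
    using K \<alpha>p(1) kappa_pos \<open>0 < c0\<close>
    by (meson diff_left_mono mult_left_mono less_imp_le order_trans pos_divide_le_eq)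
  have "inv \<alpha>c ((- K * (s - c0)) / c0 + (- K * \<kappa> + dr) / c0) + p \<le> M * V * (c0 - s)"
    if "K \<in> {c0 * V, (dr - c0 * \<alpha>c (- p)) / \<kappa>}" for K
  proof -
    have KV: "K \<le> c0 * V" using that dhK kappa_pos by (auto simp: pos_divide_le_eq)
    have "- K * \<kappa> + dr \<le> c0 * \<alpha>c (- p)" using that dhK kappa_pos by auto
    then have 1: "(- K * \<kappa> + dr) / c0 \<le> \<alpha>c (- p)"
      using \<open>0 < c0\<close> by (simp add: pos_divide_le_eq mult.commute)
    have "- K * (s - c0) \<le> c0 * V * (c0 - s)"
      using mult_right_mono[OF KV, of "c0 - s"] \<open>s < c0\<close> by (simp add: algebra_simps)
    then have 2: "(- K * (s - c0)) / c0 \<le> V * (c0 - s)"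
      using \<open>0 < c0\<close> by (subst pos_divide_le_eq) (simp_all add: mult_ac)
    have "inv \<alpha>c ((- K * (s - c0)) / c0 + (- K * \<kappa> + dr) / c0)
        \<le> inv \<alpha>c (\<alpha>c (- p) + V * (c0 - s))"
      using strict_mono_less_eq[OF smi] 1 2 by simp
    also have "\<dots> \<le> inv \<alpha>c (\<alpha>c (- p)) + M * \<bar>V * (c0 - s)\<bar>"
      using lipschitz_onD[OF assms(3), of "\<alpha>c (- p) + V * (c0 - s)" "\<alpha>c (- p)"]
      by (simp add: dist_real_def)
    finally show ?thesis using constants_pos \<open>s < c0\<close> by (simp add: inv abs_mult mult.assoc)
  qed
  note bound = this
  have "Max ((\<lambda>K. inv \<alpha>c ((- K * (s - c0)) / c0 + (- K * \<kappa> + dr) / c0)) `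
      {c0 * V, (dr - c0 * \<alpha>c (- p)) / \<kappa>}) \<le> M * V * (c0 - s) - p"
  proof (rule Max.boundedI, goal_cases)
    case (3 x)
    then show ?case
    proof (rule imageE)
      fix K assume "K \<in> {c0 * V, (dr - c0 * \<alpha>c (- p)) / \<kappa>}"
        and "x = inv \<alpha>c ((- K * (s - c0)) / c0 + (- K * \<kappa> + dr) / c0)"
      then show ?thesis using bound[of K] by linarith
    qed
  qed auto
  then show "Max ((\<lambda>K. inv \<alpha>c ((- K * (s - c0)) / c0 + (- K * \<kappa> + dr) / c0)) `
      {c0 * V, (dr - c0 * \<alpha>c (- p)) / \<kappa>}) + p \<le> M * V * (c0 - s)"
    by linarith
qed (use constants_pos in auto)

lemma admissible_design_exists: "\<exists>\<phi> c0 \<alpha>c. admissible_design N ds da db dh vbar dr \<phi> c0 \<alpha>c"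
proof -
  obtain c0 where c0: "\<kappa> + 2 * \<sigma> < c0" "c0 < 1" using kappa_sigma_less_one dense by blast
  then have c0_pos: "0 < c0" using kappa_pos sigma_pos by linarith
  have "dr < \<kappa> * c0 * V"
    using c0(1) kappa_pos constants_pos
    by (subst kappa_mult[symmetric]) (intro mult_strict_right_mono mult_strict_left_mono, auto)
  \<comment> \<open>The slope on the negative axis is so small that the saturation \<open>c0 * V\<close> beats the braking gain.\<close>
  define G where "G = \<kappa> * c0 * V - dr"
  have G: "0 < G" using \<open>dr < \<kappa> * c0 * V\<close> by (simp add: G_def)
  \<comment> \<open>Spends half of the margin: \<open>c0 * b * dh = G / 2\<close>.\<close>
  define b where "b = G / (2 * (c0 * dh))"
  have b0: "0 < b"
    using G constants_pos c0_pos unfolding b_def by (intro divide_pos_pos) auto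
  have "c0 * b * dh = G / 2" using constants_pos c0_pos by (simp add: b_def)
  then have "c0 * b * dh < G" using G by simp
  then have b: "dr + c0 * b * dh < c0 * V * \<kappa>" by (simp add: G_def mult_ac)
  \<comment> \<open>Solves \<open>c0 * \<alpha> (db / 2) - dr = c0 * V\<close>, so the first design
    inequality holds with equality.\<close>
  define a where "a = 2 * (V + dr / c0) / db"
  have a: "0 < a" unfolding a_def using constants_pos dr c0_pos
    by (intro divide_pos_pos mult_pos_pos add_pos_pos) auto
  define \<alpha> where "\<alpha> = two_slope a b"
  have \<alpha>: "class_Ke \<alpha>" "bij \<alpha>" "(max a b)-lipschitz_on UNIV \<alpha>"
      "(max (1 / a) (1 / b))-lipschitz_on UNIV (inv \<alpha>)"
    unfolding \<alpha>_def inv_two_slope[OF a b0]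
    using strict_mono_two_slope[OF a b0] bij_two_slope[OF a b0] two_slope_lipschitz[OF a b0]
      two_slope_lipschitz[of "1 / a" "1 / b"] a b0
    by (auto simp: class_Ke_def two_slope_def[of a b 0] intro: lipschitz_on_continuous_on)
  have \<alpha>db: "c0 * \<alpha> (db / 2) - dr = c0 * V"
    using constants_pos c0_pos by (simp add: \<alpha>_def two_slope_def a_def field_simps)
  have \<alpha>dh: "c0 * V > (dr - c0 * \<alpha> (- dh)) / \<kappa>"
    using constants_pos b kappa_pos by (simp add: \<alpha>_def two_slope_def pos_divide_less_eq mult.assoc)
  \<comment> \<open>The summand 1 makes the domination of \<open>phi_bound\<close> strict for
    \<open>s < c0\<close>.\<close>
  define B where "B = max (1 / a) (1 / b) * V + 1"
  have B: "0 < B" using a constants_pos unfolding B_def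
    by (intro add_nonneg_pos mult_nonneg_nonneg) (auto simp: le_max_iff_disj)
  define \<phi> where "\<phi> s = max 0 (B * (c0 - s))" for s
  have "B-lipschitz_on {-1..1} \<phi>"
    unfolding \<phi>_def
  proof (rule max_lipschitz_onI)
    show "B-lipschitz_on {-1..1} (\<lambda>s. B * (c0 - s))"
      using B by (auto intro!: lipschitz_onI simp: dist_real_def right_diff_distrib[symmetric] abs_mult
          abs_minus_commute)
    show "B-lipschitz_on {-1..1} (\<lambda>s. 0)" using B by (auto intro!: lipschitz_onI)
  qed
  moreover have "antimono_on {-1..1} \<phi>"
    using B by (intro monotone_onI) (simp add: \<phi>_def max.coboundedI2)
  moreover have "\<phi> s > phi_bound \<alpha> c0 \<kappa> dh dr vbar s" if "s < c0" for s
  proof -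
    have "phi_bound \<alpha> c0 \<kappa> dh dr vbar s \<le> max (1 / a) (1 / b) * V * (c0 - s)"
      by (rule phi_bound_le[OF \<alpha>(1,2,4) c0_pos that]) (use \<alpha>dh in simp)
    also have "\<dots> < B * (c0 - s)" unfolding B_def using that by (intro mult_strict_right_mono) auto
    finally show ?thesis by (simp add: \<phi>_def)
  qed
  moreover have "\<phi> s = 0" if "c0 \<le> s" for s
    unfolding \<phi>_def using that B by (intro max_absorb1) (simp add: mult_le_0_iff)
  moreover have "c0 > sqrt (c_star N ds da db) + sqrt (c_star N ds da db + dr / (vbar - dr))"
    using c0(1) by (simp add: kappa_eq \<sigma>_def)
  ultimately have "admissible_design N ds da db dh vbar dr \<phi> c0 \<alpha>"
    unfolding admissible_design_def using \<alpha> \<alpha>db \<alpha>dh c0(2) c0_pos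
    by (auto simp: \<phi>_def)
  then show ?thesis by blast
qed

end

subsection \<open>The quadratic program\<close>

text \<open>For the normalized vectors \<open>u\<close>, \<open>v\<close>, expanding gives
  \<open>norm x * norm y * (norm (u - v))\<^sup>2 = (norm (x - y))\<^sup>2 - (norm x - norm
  y)\<^sup>2\<close>. The constant \<open>1 / \<rho>\<close>, rather than the cruder
  \<open>2 / \<rho>\<close> of the triangle inequality, matters for the exact chord bound
  \<open>2 * \<sigma>\<close>.\<close>

lemma norm_normalized_diff_le:
  fixes x y :: "'a::real_inner"
  assumes "0 < \<rho>" "\<rho> \<le> norm x" "\<rho> \<le> norm y"
  shows "norm ((1 / norm x) *\<^sub>R x - (1 / norm y) *\<^sub>R y) \<le> norm (x - y) / \<rho>"
proof -
  define u v where "u = (1 / norm x) *\<^sub>R x" and "v = (1 / norm y) *\<^sub>R y"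
  have pos: "norm x > 0" "norm y > 0" using assms by linarith+
  then have uv: "x = norm x *\<^sub>R u" "y = norm y *\<^sub>R v" "u \<bullet> u = 1" "v \<bullet> v = 1"
    by (auto simp: u_def v_def dot_square_norm power2_eq_square)
  have "norm x * norm y * (norm (u - v))\<^sup>2 = 2 * norm x * norm y - 2 * (norm x * norm y * (u \<bullet> v))"
    by (simp add: power2_norm_eq_inner inner_diff_left inner_diff_right uv(3,4) inner_commute algebra_simps)
  also have "norm x * norm y * (u \<bullet> v) = x \<bullet> y"
    using pos by (simp add: u_def v_def)
  also have "2 * norm x * norm y - 2 * (x \<bullet> y) = (norm (x - y))\<^sup>2 - (norm x - norm y)\<^sup>2"
    by (simp add: power2_norm_eq_inner inner_diff_left inner_diff_right inner_commute
        power2_diff algebra_simps)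
  finally have "norm x * norm y * (norm (u - v))\<^sup>2 \<le> (norm (x - y))\<^sup>2" by simp
  moreover have "\<rho> * \<rho> * (norm (u - v))\<^sup>2 \<le> norm x * norm y * (norm (u - v))\<^sup>2"
    using assms by (intro mult_right_mono mult_mono) auto
  ultimately have "(\<rho> * norm (u - v))\<^sup>2 \<le> (norm (x - y))\<^sup>2"
    by (simp add: power_mult_distrib power2_eq_square[of \<rho>])
  then have "\<rho> * norm (u - v) \<le> norm (x - y)" by (rule power2_le_imp_le) simp
  then show ?thesis using assms(1) by (simp add: u_def v_def pos_le_divide_eq mult.commute)
qed

lemma Min_image_diff_le:
  fixes f g :: "'i \<Rightarrow> real"
  assumes "finite I" "I \<noteq> {}" "\<And>i. i \<in> I \<Longrightarrow> \<bar>f i - g i\<bar> \<le> e"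
  shows "\<bar>Min (f ` I) - Min (g ` I)\<bar> \<le> e"
proof -
  have *: "Min (g ` I) - Min (f ` I) \<le> e"
    if fg: "\<And>i. i \<in> I \<Longrightarrow> \<bar>f i - g i\<bar> \<le> e" for f g :: "'i \<Rightarrow> real"
  proof -
    have "Min (f ` I) \<in> f ` I" using assms by (intro Min_in) auto
    then obtain i where i: "i \<in> I" "Min (f ` I) = f i" by auto
    have "Min (g ` I) \<le> g i" using assms i by auto
    then show ?thesis using fg[OF i(1)] i(2) by linarith
  qed
  show ?thesis using *[of f g] *[of g f] assms(3) by (auto simp: abs_minus_commute abs_le_iff)
qed

text \<open>The unit norm of \<open>x\<close> forces the coefficients of a positive combination to sum up to some
  number in \<open>{1..1/c}\<close>.\<close>

lemma positive_combination_inner_le: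
  assumes "finite S" "positive_combination S x" "norm x = 1" "0 < c"
    and S: "\<And>l. l \<in> S \<Longrightarrow> norm l = 1" "\<And>l. l \<in> S \<Longrightarrow> c \<le> l \<bullet> x" "\<And>l. l \<in> S \<Longrightarrow> l \<bullet> v \<le> \<beta>"
  shows "x \<bullet> v \<le> max \<beta> (\<beta> / c)"
proof -
  obtain a where a: "\<And>l. l \<in> S \<Longrightarrow> 0 \<le> a l" "x = (\<Sum>l\<in>S. a l *\<^sub>R l)"
    using assms(2) by (auto simp: positive_combination_def)
  have inner: "x \<bullet> y = (\<Sum>l\<in>S. a l * (l \<bullet> y))" for y
    by (subst a(2)) (simp add: inner_sum_left)
  define s where "s = sum a S"
  have xx: "x \<bullet> x = 1" using assms(3) by (simp add: dot_square_norm)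
  have "s * c \<le> x \<bullet> x"
    unfolding inner s_def sum_distrib_right by (intro sum_mono mult_left_mono a S)
  then have sc: "s \<le> 1 / c" using xx assms(4) by (simp add: pos_le_divide_eq)
  have "l \<bullet> x \<le> 1" if "l \<in> S" for l
    using Cauchy_Schwarz_ineq2[of l x] assms(3) S(1)[OF that] by simp
  then have "x \<bullet> x \<le> (\<Sum>l\<in>S. a l * 1)"
    unfolding inner by (intro sum_mono mult_left_mono a)
  then have s1: "1 \<le> s" using xx by (simp add: s_def)
  have "x \<bullet> v \<le> s * \<beta>"
    unfolding inner s_def sum_distrib_right by (intro sum_mono mult_left_mono a S)
  \<comment> \<open>A nonnegative \<beta> is largest with the upper bound on \<open>s\<close>, a
    negative one with the lower bound.\<close>
  also have "\<dots> \<le> max \<beta> (\<beta> / c)"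
  proof (cases "0 \<le> \<beta>")
    case True
    then show ?thesis using mult_right_mono[OF sc True] by (simp add: le_max_iff_disj)
  next
    case False
    then show ?thesis using mult_right_mono_neg[OF s1, of \<beta>] by (simp add: le_max_iff_disj)
  qed
  finally show ?thesis .
qed

section \<open>Feasibility for a given design and positive basis\<close>

locale admissible_setting = obstacle_setting N qo ds vbar dr da db dh
  for N :: nat and qo :: "nat \<Rightarrow> real ^ 'n::finite" and ds vbar dr da db dh +
  fixes \<phi> :: "real \<Rightarrow> real" and c0 :: real and \<alpha>c :: "real \<Rightarrow> real" and \<L> :: "(real ^ 'n) set"
  assumes adm: "admissible_design N ds da db dh vbar dr \<phi> c0 \<alpha>c"
    and basis: "positive_basis c0 \<L>"
begin

text \<open>The distance from the centres at which a separation \<open>da\<close> of two centres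
  turns into the direction bound \<open>2 * \<sigma>\<close>. By \<open>da_less\<close> it lies
  below \<open>dmin\<close>; the remaining room is the tolerance \<Delta>, capped by
  \<open>dh\<close> so that the obstacle distance assumption applies.\<close>

definition "\<rho> = da / (2 * \<sigma>)"
definition "\<Delta> = min dh (dmin - \<rho>)"

definition qp_bound :: "real ^ 'n \<Rightarrow> real ^ 'n \<Rightarrow> real" where
  "qp_bound q l = min (c0 * \<alpha>c (reshaped_dist N qo ds \<phi> q l) - dr) (c0 * V)"

lemma rho_pos: "0 < \<rho>"
  using constants_pos sigma_pos by (simp add: \<rho>_def)

lemma Delta_pos: "0 < \<Delta>"
  using constants_pos sigma_pos da_less by (simp add: \<Delta>_def \<rho>_def pos_divide_less_eq mult_ac)

lemma c0: "0 < c0" "c0 < 1" "\<kappa> + 2 * \<sigma> < c0"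
  using adm by (auto simp: admissible_design_def kappa_eq \<sigma>_def)

lemma alpha: "strict_mono \<alpha>c" "\<alpha>c 0 = 0" "bij \<alpha>c"
  using adm by (auto simp: admissible_design_def class_Ke_def)

lemma alpha_le: "x \<le> y \<Longrightarrow> \<alpha>c x \<le> \<alpha>c y"
  using strict_mono_less_eq[OF alpha(1)] by blast

lemma inv_alpha: "\<alpha>c (inv \<alpha>c x) = x" "inv \<alpha>c (\<alpha>c x) = x"
  using alpha(3) by (simp_all add: bij_is_surj surj_f_inv_f bij_is_inj inv_f_f)

lemma inv_alpha_le: "x \<le> y \<Longrightarrow> inv \<alpha>c x \<le> inv \<alpha>c y"
  using strict_mono_less_eq[OF strict_mono_inv[OF alpha(1) bij_is_surj[OF alpha(3)] inv_alpha(2)]]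
  by blast

lemma finite_basis: "finite \<L>"
  using basis by (simp add: positive_basis_def)

lemma norm_basis: "l \<in> \<L> \<Longrightarrow> norm l = 1"
  using basis by (simp add: positive_basis_def)

lemma inner_le_if_basis_le:
  assumes "norm x = 1" "\<And>l. l \<in> \<L> \<Longrightarrow> c0 \<le> l \<bullet> x \<Longrightarrow> l \<bullet> v \<le> \<beta>"
  shows "x \<bullet> v \<le> max \<beta> (\<beta> / c0)"
  by (rule positive_combination_inner_le[where S = "{l\<in>\<L>. l \<bullet> x \<ge> c0}"])
     (use assms basis c0 in \<open>auto simp: positive_basis_def\<close>)

text \<open>\<open>K\<close> is the retreat speed at penetration depth \<open>p\<close>, the
  solution of \<open>K * \<kappa> = dr - c0 * \<alpha>c (- p)\<close>. It grows with
  \<open>p\<close>, so the upper bounds reduce to the design inequalities at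
  \<open>p = dh\<close>.\<close>

lemma gain_bounds:
  assumes "p \<in> {0..dh}"
  defines "K \<equiv> (dr - c0 * \<alpha>c (- p)) / \<kappa>"
  shows "0 < K" "K < c0 * \<alpha>c (db / 2) - dr" "K \<le> c0 * V"
proof -
  have "c0 * \<alpha>c (- p) \<le> 0" "c0 * \<alpha>c (- dh) \<le> c0 * \<alpha>c (- p)"
    using alpha_le[of "- p" 0] alpha_le[of "- dh" "- p"] assms c0 alpha(2)
    by (auto intro: mult_nonneg_nonpos mult_left_mono)
  then show "0 < K" using dr kappa_pos by (simp add: K_def)
  have "K \<le> (dr - c0 * \<alpha>c (- dh)) / \<kappa>"
    unfolding K_def using \<open>c0 * \<alpha>c (- dh) \<le> c0 * \<alpha>c (- p)\<close> kappa_pos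
    by (intro divide_right_mono) auto
  then show "K < c0 * \<alpha>c (db / 2) - dr" "K \<le> c0 * V"
    using adm by (auto simp: admissible_design_def)
qed

lemma phi_greater:
  assumes "p \<in> {0..dh}" "-1 \<le> s" "s < c0"
  defines "K \<equiv> (dr - c0 * \<alpha>c (- p)) / \<kappa>"
  shows "\<phi> s > inv \<alpha>c (- (K * (s - c0 + \<kappa>) - dr) / c0) + p"
proof -
  let ?g = "\<lambda>K. inv \<alpha>c ((- K * (s - c0)) / c0 + (- K * \<kappa> + dr) / c0)"
  let ?F = "\<lambda>p. Max (?g ` {c0 * V, (dr - c0 * \<alpha>c (- p)) / \<kappa>}) + p"
  have "?g K \<le> inv \<alpha>c (V * (c0 - s) + dr / c0)" if "0 \<le> K" "K \<le> c0 * V" for K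
  proof -
    have "K * (c0 - s) / c0 \<le> c0 * V * (c0 - s) / c0"
      using that assms(3) c0 by (intro divide_right_mono mult_right_mono) auto
    also have "\<dots> = V * (c0 - s)" using c0 by simp
    also have "K * (c0 - s) / c0 = (- K * (s - c0)) / c0" by (simp add: algebra_simps)
    finally have "(- K * (s - c0)) / c0 \<le> V * (c0 - s)" .
    moreover have "(- K * \<kappa> + dr) / c0 \<le> dr / c0"
      using that kappa_pos c0 by (intro divide_right_mono) auto
    ultimately show ?thesis by (intro inv_alpha_le add_mono)
  qed
  note g_le = this
  have bound: "?g ` {c0 * V, (dr - c0 * \<alpha>c (- p)) / \<kappa>}
      \<subseteq> {..inv \<alpha>c (V * (c0 - s) + dr / c0)}" if "p \<in> {0..dh}" for p
  proof (rule image_subsetI)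
    fix K assume "K \<in> {c0 * V, (dr - c0 * \<alpha>c (- p)) / \<kappa>}"
    then have "0 \<le> K" "K \<le> c0 * V" using gain_bounds[OF that] c0 constants_pos by auto
    from g_le[OF this] show "?g K \<in> {..inv \<alpha>c (V * (c0 - s) + dr / c0)}" by (simp only: atMost_iff)
  qed
  \<comment> \<open>The supremum in \<open>phi_bound\<close> dominates its entries only if they are
    bounded above; \<open>K \<le> c0 * V\<close> gives a bound uniform in \<open>p\<close>.\<close>
  have "bdd_above (?F ` {0..dh})"
  proof (rule bdd_aboveI2)
    fix p assume p: "p \<in> {0..dh}"
    have "Max (?g ` {c0 * V, (dr - c0 * \<alpha>c (- p)) / \<kappa>}) \<le> inv \<alpha>c (V * (c0 - s) + dr / c0)"
      using bound[OF p] by (intro Max.boundedI) blast+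
    then show "?F p \<le> inv \<alpha>c (V * (c0 - s) + dr / c0) + dh" using p by (intro add_mono) auto
  qed
  then have "?F p \<le> phi_bound \<alpha>c c0 \<kappa> dh dr vbar s"
    unfolding phi_bound_def by (rule cSUP_upper[OF assms(1)])
  moreover have "?g K \<le> Max (?g ` {c0 * V, (dr - c0 * \<alpha>c (- p)) / \<kappa>})"
    unfolding K_def by (rule Max_ge) auto
  moreover have "\<phi> s > phi_bound \<alpha>c c0 \<kappa> dh dr vbar s"
    using adm assms by (auto simp: admissible_design_def)
  moreover have "(- K * (s - c0)) / c0 + (- K * \<kappa> + dr) / c0 = - (K * (s - c0 + \<kappa>) - dr) / c0"
    unfolding add_divide_distrib[symmetric] by (simp add: algebra_simps)
  ultimately show ?thesis by simp
qed

lemma phi_eq_0: "c0 \<le> s \<Longrightarrow> s \<le> 1 \<Longrightarrow> \<phi> s = 0"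
  using adm by (auto simp: admissible_design_def)

lemma phi_nonneg: "-1 \<le> s \<Longrightarrow> s \<le> 1 \<Longrightarrow> 0 \<le> \<phi> s"
  using adm by (auto simp: admissible_design_def)

lemma safe_region_Delta_subset: "safe_region N qo ds \<Delta> \<subseteq> safe_region N qo ds dh"
  by (auto simp: safe_region_def \<Delta>_def)

lemma rho_le_norm:
  assumes "q \<in> safe_region N qo ds \<Delta>" "i \<in> {1..N}"
  shows "\<rho> \<le> norm (qo i - q)"
proof -
  have "- \<Delta> \<le> norm (qo i - q) - ds i" using assms by (simp add: safe_region_def obstacle_fun_def)
  moreover have "\<Delta> \<le> dmin - \<rho>" by (simp add: \<Delta>_def)
  ultimately show ?thesis using dmin_le[OF assms(2)] by linarith
qed

lemma norm_obstacle_dir: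
  assumes "q \<in> safe_region N qo ds \<Delta>" "i \<in> {1..N}"
  shows "norm (obstacle_dir qo i q) = 1"
  using rho_le_norm[OF assms] rho_pos by (auto simp: obstacle_dir_def)

lemma obstacle_dir_inner_bounds:
  assumes "q \<in> safe_region N qo ds \<Delta>" "i \<in> {1..N}" "l \<in> \<L>"
  shows "obstacle_dir qo i q \<bullet> l \<in> {-1..1}"
  using Cauchy_Schwarz_ineq2[of "obstacle_dir qo i q" l] norm_obstacle_dir[OF assms(1,2)]
    norm_basis[OF assms(3)] by (auto simp: abs_le_iff)

lemma obstacle_dirs_close:
  assumes q: "q \<in> safe_region N qo ds \<Delta>" and ij: "i \<in> {1..N}" "j \<in> {1..N}"
    and "obstacle_fun qo ds i q \<le> db / 2" "obstacle_fun qo ds j q \<le> db / 2"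
  shows "norm (obstacle_dir qo i q - obstacle_dir qo j q) \<le> 2 * \<sigma>"
proof -
  have "norm (obstacle_dir qo i q - obstacle_dir qo j q) \<le> norm ((qo i - q) - (qo j - q)) / \<rho>"
    unfolding obstacle_dir_def by (rule norm_normalized_diff_le[OF rho_pos]) (use rho_le_norm q ij in auto)
  also have "\<dots> \<le> da / \<rho>"
    using oda q safe_region_Delta_subset assms rho_pos
    by (intro divide_right_mono) (auto simp: obstacle_distance_assumption_def)
  finally show ?thesis using constants_pos by (simp add: \<rho>_def)
qed

lemma qp_feasible_iff: "qp_feasible N qo ds vbar dr \<phi> c0 \<alpha>c \<L> q v \<longleftrightarrow> v \<in> halfspaces_inter \<L> (qp_bound q)"
  by (auto simp: qp_feasible_def halfspaces_inter_def qp_bound_def)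

lemma reshaped_dist_le:
  assumes "i \<in> {1..N}"
  shows "reshaped_dist N qo ds \<phi> q l \<le> obstacle_fun qo ds i q + \<phi> (obstacle_dir qo i q \<bullet> l)"
  unfolding reshaped_dist_def obstacle_fun_def using assms by (intro Min_le) auto

lemma reshaped_dist_attained:
  obtains i where "i \<in> {1..N}"
    "reshaped_dist N qo ds \<phi> q l = obstacle_fun qo ds i q + \<phi> (obstacle_dir qo i q \<bullet> l)"
proof -
  have "reshaped_dist N qo ds \<phi> q l
      \<in> (\<lambda>i. norm (qo i - q) - ds i + \<phi> (obstacle_dir qo i q \<bullet> l)) ` {1..N}"
    unfolding reshaped_dist_def using N by (intro Min_in) auto
  then show ?thesis using that by (auto simp: obstacle_fun_def)
qed

text \<open>Retreating from the nearest obstacle \<open>i\<close> is feasible. For another obstacle \<open>j\<close> within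
  distance \<open>db / 2\<close>, \<open>obstacle_dirs_close\<close> bounds the loss in the inner product with \<open>l\<close> by
  \<open>2 * \<sigma>\<close>; all farther obstacles leave enough room because of the size of \<open>\<alpha>c (db / 2)\<close>.\<close>

lemma feasible_set_nonempty:
  assumes q: "q \<in> safe_region N qo ds \<Delta>"
  shows "halfspaces_inter \<L> (qp_bound q) \<noteq> {}"
proof -
  let ?h = "\<lambda>i. obstacle_fun qo ds i q"
  have "Min (?h ` {1..N}) \<in> ?h ` {1..N}" using N by (intro Min_in) auto
  then obtain i where i: "i \<in> {1..N}" and "Min (?h ` {1..N}) = ?h i" by auto
  then have hi: "?h i \<le> ?h j" if "j \<in> {1..N}" for j
    using that Min_le[of "?h ` {1..N}" "?h j"] by simp
  \<comment> \<open>Penetration depth into the nearest obstacle, zero outside all of them; every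
    \<open>?h j\<close> is at least \<open>- p\<close>.\<close>
  define p where "p = max 0 (- ?h i)"
  have p: "p \<in> {0..dh}"
  proof -
    have "- dh \<le> ?h i" using subsetD[OF safe_region_Delta_subset q] i by (simp add: safe_region_def)
    then show ?thesis using constants_pos by (simp add: p_def)
  qed
  define K where "K = (dr - c0 * \<alpha>c (- p)) / \<kappa>"
  note K = gain_bounds[OF p, folded K_def]
  have K\<kappa>: "K * \<kappa> = dr - c0 * \<alpha>c (- p)" using kappa_pos by (simp add: K_def)
  let ?u = "obstacle_dir qo i q"
  have "l \<bullet> ((- K) *\<^sub>R ?u) \<le> qp_bound q l" if l: "l \<in> \<L>" for l
  proof -
    have u: "?u \<bullet> l \<in> {-1..1}" by (rule obstacle_dir_inner_bounds[OF q i l])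
    have uK: "- (K * (?u \<bullet> l)) \<le> K" using mult_left_mono[of "-1" "?u \<bullet> l" K] u K(1) by simp
    obtain j where j: "j \<in> {1..N}"
      and r: "reshaped_dist N qo ds \<phi> q l = ?h j + \<phi> (obstacle_dir qo j q \<bullet> l)"
      using reshaped_dist_attained by blast
    define x where "x = obstacle_dir qo j q \<bullet> l"
    have x: "x \<in> {-1..1}" unfolding x_def by (rule obstacle_dir_inner_bounds[OF q j l])
    have "- (K * (?u \<bullet> l)) \<le> c0 * \<alpha>c (?h j + \<phi> x) - dr"
    proof (cases "?h j \<le> db / 2")
      case False
      then have "c0 * \<alpha>c (db / 2) \<le> c0 * \<alpha>c (?h j + \<phi> x)"
        using phi_nonneg[of x] x c0 by (intro mult_left_mono alpha_le) auto
      then show ?thesis using uK K(2) by linarith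
    next
      case True
      have "\<bar>(?u - obstacle_dir qo j q) \<bullet> l\<bar> \<le> norm (?u - obstacle_dir qo j q) * norm l"
        by (rule Cauchy_Schwarz_ineq2)
      also have "\<dots> \<le> 2 * \<sigma>"
        using obstacle_dirs_close[OF q i j] True hi[OF j] norm_basis[OF l] by simp
      finally have ux: "x - 2 * \<sigma> \<le> ?u \<bullet> l" by (simp add: x_def inner_diff_left abs_le_iff)
      show ?thesis
      proof (cases "c0 \<le> x")
        \<comment> \<open>Here \<phi> gives no slack, but
          \<open>?u \<bullet> l \<ge> c0 - 2 * \<sigma> > \<kappa>\<close>, so the retreat
          contributes at least \<open>K * \<kappa> = dr - c0 * \<alpha>c (- p)\<close>.\<close>
        case c0x: True
        have "K * \<kappa> \<le> K * (?u \<bullet> l)" using ux c0x c0(3) K(1) by (intro mult_left_mono) auto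
        moreover have "c0 * \<alpha>c (- p) \<le> c0 * \<alpha>c (?h j)"
          using hi[OF j] c0 by (intro mult_left_mono alpha_le) (auto simp: p_def)
        ultimately show ?thesis using K\<kappa> phi_eq_0[OF c0x] x by simp
      next
        case c0x: False
        \<comment> \<open>The summand \<open>p\<close> in the bound for \<phi> absorbs a negative
          \<open>?h j\<close>. What remains is the loss in \<open>?u \<bullet> l \<ge> x - 2 *
          \<sigma> \<ge> x - c0 + \<kappa>\<close>.\<close>
        have "inv \<alpha>c (- (K * (x - c0 + \<kappa>) - dr) / c0) \<le> ?h j + \<phi> x"
          using phi_greater[OF p, of x, folded K_def] x c0x hi[OF j] by (auto simp: p_def)
        then have "- (K * (x - c0 + \<kappa>) - dr) / c0 \<le> \<alpha>c (?h j + \<phi> x)"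
          using alpha_le inv_alpha(1) by metis
        then have "- (K * (x - c0 + \<kappa>) - dr) \<le> c0 * \<alpha>c (?h j + \<phi> x)"
          using c0 by (simp add: pos_divide_le_eq mult.commute)
        moreover have "K * (x - c0 + \<kappa>) \<le> K * (?u \<bullet> l)"
          using ux c0(3) K(1) by (intro mult_left_mono) auto
        ultimately show ?thesis by simp
      qed
    qed
    then show ?thesis
      using uK K(3) r by (simp add: qp_bound_def x_def inner_commute)
  qed
  then have "(- K) *\<^sub>R ?u \<in> halfspaces_inter \<L> (qp_bound q)" by (simp add: halfspaces_inter_def)
  then show ?thesis by blast
qed

section \<open>The solution map: speed, obstacle and Lipschitz bounds\<close>

lemma qp_solution_iff:
  assumes "q \<in> safe_region N qo ds \<Delta>"
  shows "qp_solution N qo ds vbar dr \<phi> c0 \<alpha>c \<L> q w v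
    \<longleftrightarrow> v = closest_point (halfspaces_inter \<L> (qp_bound q)) w"
proof -
  let ?P = "halfspaces_inter \<L> (qp_bound q)"
  have sol: "qp_solution N qo ds vbar dr \<phi> c0 \<alpha>c \<L> q w v \<longleftrightarrow> v \<in> ?P \<and> (\<forall>y\<in>?P. dist w v \<le> dist w y)"
    by (auto simp: qp_solution_def is_arg_min_def qp_feasible_iff dist_norm norm_minus_commute not_less
        power2_le_iff_abs_le)
  show ?thesis
    unfolding sol
    using closest_point_unique[OF convex_halfspaces_inter closed_halfspaces_inter, of v \<L> "qp_bound q" w]
      closest_point_exists[OF closed_halfspaces_inter feasible_set_nonempty[OF assms], of w]
    by blast
qed

lemma qp_map_eq:
  assumes "q \<in> safe_region N qo ds \<Delta>"
  shows "qp_map N qo ds vbar dr \<phi> c0 \<alpha>c \<L> q w = closest_point (halfspaces_inter \<L> (qp_bound q)) w"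
  by (simp add: qp_map_def qp_solution_iff[OF assms])

lemma qp_map_feasible:
  assumes "q \<in> safe_region N qo ds \<Delta>" "l \<in> \<L>"
  shows "l \<bullet> qp_map N qo ds vbar dr \<phi> c0 \<alpha>c \<L> q w \<le> qp_bound q l"
  using closest_point_in_set[OF closed_halfspaces_inter feasible_set_nonempty[OF assms(1)], of w] assms(2)
  by (simp add: qp_map_eq[OF assms(1)] halfspaces_inter_def)

text \<open>The solution is tested against its own direction. Passing from basis vectors to
  \<open>sgn v\<close> costs a factor \<open>1 / c0\<close>, which the factor \<open>c0\<close> in
  the speed constraint compensates.\<close>

lemma norm_qp_map_le:
  assumes "q \<in> safe_region N qo ds \<Delta>"
  shows "norm (qp_map N qo ds vbar dr \<phi> c0 \<alpha>c \<L> q w) \<le> V"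
proof (cases "qp_map N qo ds vbar dr \<phi> c0 \<alpha>c \<L> q w = 0")
  case True
  then show ?thesis using constants_pos by simp
next
  case False
  define v where "v = qp_map N qo ds vbar dr \<phi> c0 \<alpha>c \<L> q w"
  have "sgn v \<bullet> v \<le> max (c0 * V) (c0 * V / c0)"
    by (rule inner_le_if_basis_le)
       (use False qp_map_feasible[OF assms] in \<open>auto simp: v_def norm_sgn qp_bound_def\<close>)
  also have "\<dots> = V"
    using c0 constants_pos mult_right_mono[of c0 1 V] by (simp add: max_def)
  also have "sgn v \<bullet> v = norm v"
    using False by (simp add: v_def sgn_div_norm dot_square_norm power2_eq_square)
  finally show ?thesis by (simp add: v_def)
qed

text \<open>On basis vectors in the cone of \<open>c0\<close> around the obstacle direction \<phi>
  vanishes, so their constraints see the true distance \<open>s\<close>. The two terms of the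
  maximum reflect the range \<open>{1..1/c0}\<close> of the coefficient sum.\<close>

lemma obstacle_dir_inner_qp_map_le:
  assumes q: "q \<in> safe_region N qo ds \<Delta>" and i: "i \<in> {1..N}"
  defines "s \<equiv> obstacle_fun qo ds i q"
  shows "obstacle_dir qo i q \<bullet> qp_map N qo ds vbar dr \<phi> c0 \<alpha>c \<L> q w \<le> max (\<alpha>c s) (c0 * \<alpha>c s) - dr"
proof -
  define \<beta> where "\<beta> = c0 * \<alpha>c s - dr"
  have "obstacle_dir qo i q \<bullet> qp_map N qo ds vbar dr \<phi> c0 \<alpha>c \<L> q w \<le> max \<beta> (\<beta> / c0)"
  proof (rule inner_le_if_basis_le[OF norm_obstacle_dir[OF q i]])
    fix l assume l: "l \<in> \<L>" "c0 \<le> l \<bullet> obstacle_dir qo i q"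
    have "\<phi> (obstacle_dir qo i q \<bullet> l) = 0"
      using l obstacle_dir_inner_bounds[OF q i l(1)] by (intro phi_eq_0) (auto simp: inner_commute)
    then have "reshaped_dist N qo ds \<phi> q l \<le> s"
      using reshaped_dist_le[OF i, of q l] by (simp add: s_def)
    then have "c0 * \<alpha>c (reshaped_dist N qo ds \<phi> q l) \<le> c0 * \<alpha>c s"
      using c0 by (intro mult_left_mono alpha_le) auto
    then show "l \<bullet> qp_map N qo ds vbar dr \<phi> c0 \<alpha>c \<L> q w \<le> \<beta>"
      using qp_map_feasible[OF q l(1), of w] by (simp add: qp_bound_def \<beta>_def)
  qed
  moreover have "\<beta> / c0 \<le> \<alpha>c s - dr"
  proof -
    have "dr \<le> dr / c0" using c0 dr by (simp add: pos_le_divide_eq)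
    then show ?thesis using c0 by (simp add: \<beta>_def diff_divide_distrib)
  qed
  ultimately show ?thesis by (simp add: \<beta>_def)
qed

lemma obstacle_fun_has_derivative:
  assumes "q \<noteq> qo i"
  shows "(obstacle_fun qo ds i has_derivative (\<lambda>h. - (obstacle_dir qo i q \<bullet> h))) (at q)"
proof -
  have "((\<lambda>q. norm (qo i - q) - ds i) has_derivative (\<lambda>h. (- h) \<bullet> sgn (qo i - q))) (at q)"
    by (rule derivative_eq_intros refl has_derivative_compose[OF _ has_derivative_norm] | use assms in simp)+
  moreover have "sgn (qo i - q) = obstacle_dir qo i q"
    by (simp add: obstacle_dir_def sgn_div_norm inverse_eq_divide)
  ultimately show ?thesis
    by (simp add: obstacle_fun_def[abs_def] inner_commute)
qed

lemma obstacle_fun_derivative_ge: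
  assumes q: "q \<in> safe_region N qo ds \<Delta>" and i: "i \<in> {1..N}"
  defines "s \<equiv> obstacle_fun qo ds i q"
  shows "obstacle_fun qo ds i differentiable (at q)"
    and "frechet_derivative (obstacle_fun qo ds i) (at q) (qp_map N qo ds vbar dr \<phi> c0 \<alpha>c \<L> q w + e)
           \<ge> - max (\<alpha>c s) (c0 * \<alpha>c s) + dr - norm e"
proof -
  have "q \<noteq> qo i" using rho_le_norm[OF q i] rho_pos by auto
  note D = obstacle_fun_has_derivative[OF this]
  show "obstacle_fun qo ds i differentiable (at q)" using D by (rule differentiableI)
  have "\<bar>obstacle_dir qo i q \<bullet> e\<bar> \<le> norm e"
    using Cauchy_Schwarz_ineq2[of "obstacle_dir qo i q" e] norm_obstacle_dir[OF q i] by simp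
  then show "frechet_derivative (obstacle_fun qo ds i) (at q) (qp_map N qo ds vbar dr \<phi> c0 \<alpha>c \<L> q w + e)
           \<ge> - max (\<alpha>c s) (c0 * \<alpha>c s) + dr - norm e"
    using obstacle_dir_inner_qp_map_le[OF q i, of w]
    unfolding frechet_derivative_at[OF D, symmetric] s_def by (simp add: inner_add_right)
qed

text \<open>All centres stay at distance at least \<rho>, so directions are
  \<open>1 / \<rho>\<close>-Lipschitz between any two safe positions, however the segment between
  them runs; \<phi>, the minimum over obstacles and \<alpha>c preserve this.\<close>

lemma qp_bound_lipschitz:
  "\<exists>M\<ge>0. \<forall>q1\<in>safe_region N qo ds \<Delta>. \<forall>q2\<in>safe_region N qo ds \<Delta>. \<forall>l\<in>\<L>.
     \<bar>qp_bound q1 l - qp_bound q2 l\<bar> \<le> M * norm (q1 - q2)"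
proof -
  obtain M\<phi> where M\<phi>: "M\<phi>-lipschitz_on {-1..1} \<phi>" using adm by (auto simp: admissible_design_def)
  obtain M\<alpha> where M\<alpha>: "M\<alpha>-lipschitz_on UNIV \<alpha>c" using adm by (auto simp: admissible_design_def)
  note nonneg = lipschitz_on_nonneg[OF M\<phi>] lipschitz_on_nonneg[OF M\<alpha>]
  define C where "C = 1 + M\<phi> / \<rho>"
  have "\<bar>qp_bound q1 l - qp_bound q2 l\<bar> \<le> c0 * M\<alpha> * C * norm (q1 - q2)"
    if q1: "q1 \<in> safe_region N qo ds \<Delta>" and q2: "q2 \<in> safe_region N qo ds \<Delta>" and l: "l \<in> \<L>" for q1 q2 l
  proof -
    let ?r = "\<lambda>q. reshaped_dist N qo ds \<phi> q l"
    have "\<bar>?r q1 - ?r q2\<bar> \<le> C * norm (q1 - q2)"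
      unfolding reshaped_dist_def
    proof (rule Min_image_diff_le)
      fix i assume i: "i \<in> {1..N}"
      let ?u = "\<lambda>q. obstacle_dir qo i q"
      have diff: "(qo i - q1) - (qo i - q2) = q2 - q1" by simp
      have "norm (?u q1 - ?u q2) \<le> norm ((qo i - q1) - (qo i - q2)) / \<rho>"
        unfolding obstacle_dir_def
        by (rule norm_normalized_diff_le[OF rho_pos rho_le_norm[OF q1 i] rho_le_norm[OF q2 i]])
      moreover have "\<bar>?u q1 \<bullet> l - ?u q2 \<bullet> l\<bar> \<le> norm (?u q1 - ?u q2)"
        using Cauchy_Schwarz_ineq2[of "?u q1 - ?u q2" l] norm_basis[OF l] by (simp add: inner_diff_left)
      ultimately have u: "\<bar>?u q1 \<bullet> l - ?u q2 \<bullet> l\<bar> \<le> norm (q1 - q2) / \<rho>"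
        unfolding diff by (simp add: norm_minus_commute)
      have "\<bar>\<phi> (?u q1 \<bullet> l) - \<phi> (?u q2 \<bullet> l)\<bar> \<le> M\<phi> * \<bar>?u q1 \<bullet> l - ?u q2 \<bullet> l\<bar>"
        using lipschitz_onD[OF M\<phi> obstacle_dir_inner_bounds[OF q1 i l] obstacle_dir_inner_bounds[OF q2 i l]]
        by (simp add: dist_real_def)
      also have "\<dots> \<le> M\<phi> * (norm (q1 - q2) / \<rho>)" by (intro mult_left_mono u nonneg)
      finally have "\<bar>\<phi> (?u q1 \<bullet> l) - \<phi> (?u q2 \<bullet> l)\<bar> \<le> M\<phi> / \<rho> * norm (q1 - q2)" by simp
      moreover have "\<bar>norm (qo i - q1) - norm (qo i - q2)\<bar> \<le> norm (q1 - q2)"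
        using norm_triangle_ineq3[of "qo i - q1" "qo i - q2"] unfolding diff
        by (simp add: norm_minus_commute)
      ultimately show "\<bar>norm (qo i - q1) - ds i + \<phi> (?u q1 \<bullet> l) - (norm (qo i - q2) - ds i + \<phi> (?u q2 \<bullet> l))\<bar>
          \<le> C * norm (q1 - q2)"
        unfolding C_def distrib_right by linarith
    qed (use N in auto)
    then have "M\<alpha> * \<bar>?r q1 - ?r q2\<bar> \<le> M\<alpha> * (C * norm (q1 - q2))"
      by (intro mult_left_mono nonneg)
    then have "\<bar>\<alpha>c (?r q1) - \<alpha>c (?r q2)\<bar> \<le> M\<alpha> * (C * norm (q1 - q2))"
      using lipschitz_onD[OF M\<alpha>, of "?r q1" "?r q2"] by (simp add: dist_real_def)
    then have "c0 * \<bar>\<alpha>c (?r q1) - \<alpha>c (?r q2)\<bar> \<le> c0 * (M\<alpha> * (C * norm (q1 - q2)))"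
      using c0 by (intro mult_left_mono) auto
    then have "\<bar>c0 * \<alpha>c (?r q1) - c0 * \<alpha>c (?r q2)\<bar> \<le> c0 * M\<alpha> * C * norm (q1 - q2)"
      using c0 by (simp add: right_diff_distrib[symmetric] abs_mult mult.assoc)
    then show ?thesis unfolding qp_bound_def by linarith
  qed
  moreover have "0 \<le> c0 * M\<alpha> * C" using c0 nonneg rho_pos by (simp add: C_def)
  ultimately show ?thesis by blast
qed

text \<open>Inserting the projection of \<open>w2\<close> onto the first polyhedron separates the
  effects: changing \<open>w\<close> is nonexpansive, and changing \<open>q\<close> only shifts the
  right-hand sides.\<close>

lemma qp_map_lipschitz:
  "\<exists>L>0. \<forall>q1\<in>safe_region N qo ds \<Delta>. \<forall>q2\<in>safe_region N qo ds \<Delta>. \<forall>w1 w2.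
     norm (qp_map N qo ds vbar dr \<phi> c0 \<alpha>c \<L> q1 w1 - qp_map N qo ds vbar dr \<phi> c0 \<alpha>c \<L> q2 w2)
       \<le> L * (norm (q1 - q2) + norm (w1 - w2))"
proof -
  obtain M where M: "M \<ge> 0" "\<And>w b b'. halfspaces_inter \<L> b \<noteq> {} \<Longrightarrow> halfspaces_inter \<L> b' \<noteq> {} \<Longrightarrow>
      norm (closest_point (halfspaces_inter \<L> b) w - closest_point (halfspaces_inter \<L> b') w)
        \<le> M * (\<Sum>l\<in>\<L>. \<bar>b l - b' l\<bar>)"
    using closest_point_halfspaces_inter_lipschitz[OF finite_basis] by blast
  obtain M' where M': "M' \<ge> 0" "\<And>q1 q2 l. q1 \<in> safe_region N qo ds \<Delta> \<Longrightarrow>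
      q2 \<in> safe_region N qo ds \<Delta> \<Longrightarrow> l \<in> \<L> \<Longrightarrow> \<bar>qp_bound q1 l - qp_bound q2 l\<bar> \<le> M' * norm (q1 - q2)"
    using qp_bound_lipschitz by blast
  define L where "L = 1 + M * (card \<L> * M')"
  have L: "1 \<le> L" "M * (card \<L> * M') \<le> L" using M(1) M'(1) by (auto simp: L_def)
  have "norm (qp_map N qo ds vbar dr \<phi> c0 \<alpha>c \<L> q1 w1 - qp_map N qo ds vbar dr \<phi> c0 \<alpha>c \<L> q2 w2)
       \<le> L * (norm (q1 - q2) + norm (w1 - w2))"
    if q1: "q1 \<in> safe_region N qo ds \<Delta>" and q2: "q2 \<in> safe_region N qo ds \<Delta>" for q1 q2 w1 w2
  proof -
    let ?p = "\<lambda>q w. closest_point (halfspaces_inter \<L> (qp_bound q)) w"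
    note ne = feasible_set_nonempty[OF q1] feasible_set_nonempty[OF q2]
    have "norm (?p q1 w1 - ?p q2 w2) \<le> norm (?p q1 w1 - ?p q1 w2) + norm (?p q1 w2 - ?p q2 w2)"
      using norm_triangle_ineq[of "?p q1 w1 - ?p q1 w2" "?p q1 w2 - ?p q2 w2"] by simp
    moreover have "norm (?p q1 w1 - ?p q1 w2) \<le> 1 * norm (w1 - w2)"
      using closest_point_lipschitz[OF convex_halfspaces_inter closed_halfspaces_inter ne(1)]
      by (simp add: dist_norm)
    moreover have "norm (?p q1 w2 - ?p q2 w2) \<le> M * (card \<L> * M') * norm (q1 - q2)"
    proof -
      have "norm (?p q1 w2 - ?p q2 w2) \<le> M * (\<Sum>l\<in>\<L>. \<bar>qp_bound q1 l - qp_bound q2 l\<bar>)"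
        by (rule M(2)[OF ne])
      also have "\<dots> \<le> M * (\<Sum>l\<in>\<L>. M' * norm (q1 - q2))"
        by (intro mult_left_mono sum_mono M M' q1 q2)
      finally show ?thesis by (simp add: mult.assoc)
    qed
    moreover have "1 * norm (w1 - w2) \<le> L * norm (w1 - w2)"
      "M * (card \<L> * M') * norm (q1 - q2) \<le> L * norm (q1 - q2)"
      by (intro mult_right_mono L norm_ge_zero)+
    ultimately show ?thesis
      unfolding qp_map_eq[OF q1] qp_map_eq[OF q2] distrib_left by linarith
  qed
  moreover have "0 < L" using L(1) by linarith
  ultimately show ?thesis by blast
qed

end

theorem proposition1:
  fixes N :: nat and qo :: "nat \<Rightarrow> real ^ 'n::finite" and ds :: "nat \<Rightarrow> real"
    and vbar dr da db dh vcbar vcd :: real and vc vc' :: "real \<Rightarrow> real ^ 'n"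
  assumes "N \<ge> 1"
    and "\<forall>i\<in>{1..N}. ds i > 0" and "vbar > 0" and "dr > 0"
    and "vcbar > 0" and "vcd > 0"
    and "\<forall>t\<ge>0. norm (vc t) \<le> vcbar"
    and "\<forall>t\<ge>0. (vc has_vector_derivative vc' t) (at t within {0..}) \<and> norm (vc' t) \<le> vcd"
    and "obstacle_distance_assumption N qo ds da db dh"
    and "sqrt 2 * Min (ds ` {1..N}) > da"
    and "vbar > 2 * dr"
    and "(2 * (Min (ds ` {1..N}))\<^sup>2 - da\<^sup>2) / (2 * (Max (ds ` {1..N}) + db / 2)\<^sup>2)
           > 1 - (vbar - 2 * dr)\<^sup>2 / (2 * (vbar - dr)\<^sup>2)"
  shows "(\<exists>\<phi> c0 \<alpha>c. admissible_design N ds da db dh vbar dr \<phi> c0 \<alpha>c) \<and>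
    (\<forall>\<phi> c0 \<alpha>c \<L>.
       admissible_design N ds da db dh vbar dr \<phi> c0 \<alpha>c \<and> positive_basis c0 (\<L> :: (real ^ 'n) set) \<longrightarrow>
       (\<exists>\<Delta>h>0.
          (\<forall>q\<in>safe_region N qo ds \<Delta>h. \<forall>w. \<exists>!v. qp_solution N qo ds vbar dr \<phi> c0 \<alpha>c \<L> q w v) \<and>
          (\<forall>(q :: real \<Rightarrow> real ^ 'n) (vtilde :: real \<Rightarrow> real ^ 'n) vstar qdot. \<forall>t\<ge>0.
             q t \<in> safe_region N qo ds \<Delta>h \<and>
             vstar = qp_map N qo ds vbar dr \<phi> c0 \<alpha>c \<L> (q t) (vc t) \<and>
             qdot = vstar + vtilde t \<and>
             (q has_vector_derivative qdot) (at t within {0..}) \<longrightarrow>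
             (\<forall>i\<in>{1..N}.
                obstacle_fun qo ds i differentiable (at (q t)) \<and>
                frechet_derivative (obstacle_fun qo ds i) (at (q t)) qdot
                  \<ge> - max (\<alpha>c (obstacle_fun qo ds i (q t))) (c0 * \<alpha>c (obstacle_fun qo ds i (q t)))
                     + dr - norm (vtilde t)) \<and>
             norm vstar \<le> vbar - dr) \<and>
          (\<exists>L>0. \<forall>q1\<in>safe_region N qo ds \<Delta>h. \<forall>q2\<in>safe_region N qo ds \<Delta>h. \<forall>w1 w2.
             norm (qp_map N qo ds vbar dr \<phi> c0 \<alpha>c \<L> q1 w1 - qp_map N qo ds vbar dr \<phi> c0 \<alpha>c \<L> q2 w2)
               \<le> L * (norm (q1 - q2) + norm (w1 - w2)))))"
proof (intro conjI allI impI)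
  interpret obstacle_setting N qo ds vbar dr da db dh
    using assms by unfold_locales
  show "\<exists>\<phi> c0 \<alpha>c. admissible_design N ds da db dh vbar dr \<phi> c0 \<alpha>c"
    by (rule admissible_design_exists)
next
  fix \<phi> c0 \<alpha>c and \<L> :: "(real ^ 'n) set"
  assume "admissible_design N ds da db dh vbar dr \<phi> c0 \<alpha>c \<and> positive_basis c0 \<L>"
  then interpret admissible_setting N qo ds vbar dr da db dh \<phi> c0 \<alpha>c \<L>
    using assms by unfold_locales auto
  show "\<exists>\<Delta>h>0.
          (\<forall>q\<in>safe_region N qo ds \<Delta>h. \<forall>w. \<exists>!v. qp_solution N qo ds vbar dr \<phi> c0 \<alpha>c \<L> q w v) \<and>
          (\<forall>(q :: real \<Rightarrow> real ^ 'n) (vtilde :: real \<Rightarrow> real ^ 'n) vstar qdot. \<forall>t\<ge>0.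
             q t \<in> safe_region N qo ds \<Delta>h \<and>
             vstar = qp_map N qo ds vbar dr \<phi> c0 \<alpha>c \<L> (q t) (vc t) \<and>
             qdot = vstar + vtilde t \<and>
             (q has_vector_derivative qdot) (at t within {0..}) \<longrightarrow>
             (\<forall>i\<in>{1..N}.
                obstacle_fun qo ds i differentiable (at (q t)) \<and>
                frechet_derivative (obstacle_fun qo ds i) (at (q t)) qdot
                  \<ge> - max (\<alpha>c (obstacle_fun qo ds i (q t))) (c0 * \<alpha>c (obstacle_fun qo ds i (q t)))
                     + dr - norm (vtilde t)) \<and>
             norm vstar \<le> vbar - dr) \<and>
          (\<exists>L>0. \<forall>q1\<in>safe_region N qo ds \<Delta>h. \<forall>q2\<in>safe_region N qo ds \<Delta>h. \<forall>w1 w2.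
             norm (qp_map N qo ds vbar dr \<phi> c0 \<alpha>c \<L> q1 w1 - qp_map N qo ds vbar dr \<phi> c0 \<alpha>c \<L> q2 w2)
               \<le> L * (norm (q1 - q2) + norm (w1 - w2)))"
  \<comment> \<open>The tolerance \<Delta> depends only on the obstacle geometry, not on the design
    or the basis.\<close>
  proof (rule exI[of _ \<Delta>], intro conjI, goal_cases)
    case 1
    show ?case by (rule Delta_pos)
  next
    case 2
    show ?case by (simp add: qp_solution_iff)
  next
    case 3
    show ?case
      by (intro allI impI conjI ballI; elim conjE; hypsubst)
         (rule obstacle_fun_derivative_ge norm_qp_map_le; assumption)+
  next
    case 4
    show ?case by (rule qp_map_lipschitz)
  qed
qed

end
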